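(* There exist absolute constants $c_1,c_2,c_3,c_4>0$ such that for all integers $b,g,m,n,k,N$ with $b\ge n>m\ge1$, $1\le g\le n$, $1\le k\le 2^n$, $2\le N\le 2^m$, with $\gamma$ defined by $N=\gamma2^m$, and all real $\epsilon$ with $0<\epsilon\le2$, $$\ln\Big(\mu_{\Delta(N,2^m)^k}\big(X(b,g,m,n;N,2-\epsilon,k)\big)\Big)\le 2^{c_1g}\,b\ln(2b/\epsilon)+c_2mk-\big(c_3\epsilon-c_4\gamma^{1/4}\big)\gamma2^mk,$$ where $\ln0=-\infty$.
   Context: Probability simplices. $\Delta(N)=\{\mathbf x\in\mathbb R^N: x_i\ge 0 \text{ for all } i,\ \sum_i x_i=1\}$. For a subset $S\subseteq\{1,\dots,N\}$ let $\Delta(S,N)$ be the face $\{\mathbf x\in\Delta(N): x_i=0 \text{ for } i\notin S\}$, and $\Delta(N',N)=\bigcup_{|S|=N'}\Delta(S,N)$, so $\Delta(N,N)=\Delta(N)$. $\Delta(N',N)^k$ is the set of $k$-tuples of members of $\Delta(N',N)$; $\mu_{\Delta(N',N)^k}$ is the uniform probability measure on it, i.e. the Lebesgue measure of the appropriate dimension normalized to total mass 1 (equivalently the $k$-fold product of the measure that chooses $S$ with $|S|=N'$ uniformly and then a uniformly distributed point of $\Delta(S,N)$). For $\mathbf x,\mathbf y\in\Delta(N)$ the total variation distance (TVD) is $|\mathbf x-\mathbf y|_1=\sum_i|x_i-y_i|$; for $k$-tuples $\mathbf x=(\mathbf x_1,\dots,\mathbf x_k),\mathbf y=(\mathbf y_1,\dots,\mathbf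 y_k)\in\Delta(N)^k$ it is the average $|\mathbf x-\mathbf y|_1=\frac1k\sum_{i=1}^k|\mathbf x_i-\mathbf y_i|_1$. Quantum circuits. $H_n=(\mathbb C^2)^{\otimes n}$ with standard orthonormal basis $|b_1b_2\dots b_n\rangle$, $b_i\in\{0,1\}$; for $0\le j<2^n$, $|j\rangle$ denotes the basis vector given by the binary digits of $j$ in reverse order ($j=\sum_i b_i2^{i-1}$). A $g$-input quantum gate is a unitary operator $V$ on $H_g$; applied to a choice of $g$ of the $n$ qubits it acts on $H_n\cong H_g\otimes H_{n-g}$ as $V\otimes I$, the factor $H_g$ corresponding to the chosen qubits. $G_g^{(b,n)}$ is the set of unitary operators on $H_n$ expressible as a composition of at most $b$ $g$-input gates (each with its own choice of $g$ qubits). For a unit vector $|x\rangle\in H_n$ and $m\le n$, $\mathrm{Prob}_m(\cdot\mid|x\rangle)\in\Delta(2^m)$ is the distribution on $m$-bit vectors $c$ given by $\mathrm{Prob}_m(c\mid|x\rangle)=\sum_{c'\in\{0,1\}^{n-m}}|\langle cc'|x\rangle|^2$. For $U$ unitary on $H_n$, $\phi_m(U)\in\Delta(2^m)^k$ is the $k$-tuple $(\mathrm{Prob}_m(\cdot\mid U|0\rangle),\dots,\mathrm{Prob}_m(\cdot\mid U|k-1\rangle))$. $X(b,g,m,n;N,d,k)$ is the set of members of $\Delta(N,2^m)^k$ which are within average TVD $d$ of some element of $\phi_m(G_g^{(b,n)})$. *)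

theory Defs
  imports
    "HOL-Probability.Probability"
    "Jordan_Normal_Form.Schur_Decomposition"
begin

hide_const (open) Finite_Cartesian_Product.mat Finite_Cartesian_Product.vec
no_notation vec_nth (infixl \<open>$\<close> 90)

section \<open>Probability simplices\<close>

text \<open>
  Coordinates are numbered from \<open>0\<close>. Points of \<open>\<real>\<^sup>D\<close> are functions that are extensional on
  \<open>{..<D}\<close>, i.e. elements of the underlying space of \<open>\<Pi>\<^sub>M i\<in>{..<D}. borel\<close>; \<open>k\<close>-tuples are
  treated in the same way.
\<close>

definition prob_simplex :: "nat \<Rightarrow> (nat \<Rightarrow> real) set" where
  "prob_simplex D = {x \<in> extensional {..<D}. (\<forall>i<D. 0 \<le> x i) \<and> (\<Sum>i<D. x i) = 1}"

definition simplex_face :: "nat set \<Rightarrow> nat \<Rightarrow> (nat \<Rightarrow> real) set" where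
  "simplex_face S D = {x \<in> prob_simplex D. \<forall>i<D. i \<notin> S \<longrightarrow> x i = 0}"

definition sparse_simplex :: "nat \<Rightarrow> nat \<Rightarrow> (nat \<Rightarrow> real) set" where
  "sparse_simplex N D = (\<Union>S \<in> {S. S \<subseteq> {..<D} \<and> card S = N}. simplex_face S D)"

definition corner_simplex :: "nat set \<Rightarrow> (nat \<Rightarrow> real) set" where
  "corner_simplex T = {y \<in> extensional T. (\<forall>i\<in>T. 0 \<le> y i) \<and> (\<Sum>i\<in>T. y i) \<le> 1}"

text \<open>
  The uniform distribution on a face. Forgetting the coordinate \<open>Max S\<close> is an affine bijection from
  \<^term>\<open>simplex_face S D\<close> onto \<^term>\<open>corner_simplex (S - {Max S})\<close>. It multiplies Lebesgue measure
  of dimension \<open>card S - 1\<close> by a constant, so the normalized Lebesgue measure on the face is the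
  image of the normalized Lebesgue measure under the inverse map. Which coordinate is
  forgotten is immaterial.
\<close>

definition face_lift :: "nat set \<Rightarrow> nat \<Rightarrow> (nat \<Rightarrow> real) \<Rightarrow> nat \<Rightarrow> real" where
  "face_lift S D y =
     (\<lambda>i\<in>{..<D}. if i \<in> S - {Max S} then y i
                 else if i = Max S then 1 - (\<Sum>l\<in>S - {Max S}. y l) else 0)"

definition face_unif :: "nat set \<Rightarrow> nat \<Rightarrow> (nat \<Rightarrow> real) measure" where
  "face_unif S D =
     distr (uniform_measure (\<Pi>\<^sub>M i\<in>S - {Max S}. lborel) (corner_simplex (S - {Max S})))
       (\<Pi>\<^sub>M i\<in>{..<D}. borel) (face_lift S D)"

text \<open>
  \<^term>\<open>uniform_count_measure\<close> rather than a \<open>pmf\<close> is used for the choice of the support, because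
  the kernel \<^term>\<open>\<lambda>S. face_unif S D\<close> is a probability measure only for sets \<open>S\<close> in its range.
\<close>

definition sparse_unif :: "nat \<Rightarrow> nat \<Rightarrow> (nat \<Rightarrow> real) measure" where
  "sparse_unif N D =
     uniform_count_measure {S. S \<subseteq> {..<D} \<and> card S = N} \<bind> (\<lambda>S. face_unif S D)"

definition tuple_unif :: "nat \<Rightarrow> nat \<Rightarrow> nat \<Rightarrow> (nat \<Rightarrow> nat \<Rightarrow> real) measure" where
  "tuple_unif k N D = (\<Pi>\<^sub>M j\<in>{..<k}. sparse_unif N D)"

text \<open>The total variation distance is used without the factor \<open>1/2\<close>, so it ranges over \<open>[0, 2]\<close>.\<close>

definition tvd :: "nat \<Rightarrow> (nat \<Rightarrow> real) \<Rightarrow> (nat \<Rightarrow> real) \<Rightarrow> real" where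
  "tvd D x y = (\<Sum>i<D. \<bar>x i - y i\<bar>)"

definition avg_tvd :: "nat \<Rightarrow> nat \<Rightarrow> (nat \<Rightarrow> nat \<Rightarrow> real) \<Rightarrow> (nat \<Rightarrow> nat \<Rightarrow> real) \<Rightarrow> real" where
  "avg_tvd k D x y = (1 / real k) * (\<Sum>j<k. tvd D (x j) (y j))"


section \<open>Quantum circuits\<close>

text \<open>
  The state space of \<open>n\<close> qubits is \<open>\<complex>\<close> to the power \<open>2\<^sup>n\<close>. The standard basis vector with binary
  digits \<open>b\<^sub>1 \<dots> b\<^sub>n\<close> is the unit vector with index \<open>j = \<Sum>\<^sub>i b\<^sub>i 2\<^bsup>i-1\<^esup>\<close>. Qubits are numbered
  from \<open>0\<close>, so that the digit of qubit \<open>i < n\<close> in \<open>j\<close> is \<^term>\<open>bit j i\<close>.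
\<close>

definition unitary_mats :: "nat \<Rightarrow> complex mat set" where
  "unitary_mats d = {V \<in> carrier_mat d d. mat_adjoint V * V = 1\<^sub>m d \<and> V * mat_adjoint V = 1\<^sub>m d}"

text \<open>
  \<open>q\<close> is an injective map from \<open>{..<g}\<close> to \<open>{..<n}\<close>: the \<open>i\<close>-th input of a gate is qubit \<open>q i\<close>.
  \<open>sub_index g q j\<close> is the basis index for \<open>g\<close> qubits that consists of the digits of \<open>j\<close> at the
  chosen qubits. The matrix \<open>gate_on g n q V\<close> is \<open>V \<otimes> I\<close>, the first factor belonging to the chosen
  qubits: its entries are those of \<open>V\<close> on the chosen qubits times those of the identity matrix
  on the remaining ones.
\<close>

definition sub_index :: "nat \<Rightarrow> (nat \<Rightarrow> nat) \<Rightarrow> nat \<Rightarrow> nat" where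
  "sub_index g q j = (\<Sum>i<g. of_bool (bit j (q i)) * 2 ^ i)"

definition gate_on :: "nat \<Rightarrow> nat \<Rightarrow> (nat \<Rightarrow> nat) \<Rightarrow> complex mat \<Rightarrow> complex mat" where
  "gate_on g n q V =
     mat (2 ^ n) (2 ^ n) (\<lambda>(r, c).
       if \<forall>i<n. i \<notin> q ` {..<g} \<longrightarrow> bit r i = bit c i
       then V $$ (sub_index g q r, sub_index g q c) else 0)"

definition gates :: "nat \<Rightarrow> nat \<Rightarrow> complex mat set" where
  "gates g n =
     {gate_on g n q V | q V. q ` {..<g} \<subseteq> {..<n} \<and> inj_on q {..<g} \<and> V \<in> unitary_mats (2 ^ g)}"

definition circuits :: "nat \<Rightarrow> nat \<Rightarrow> nat \<Rightarrow> complex mat set" where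
  "circuits g b n =
     {U. \<exists>Vs. length Vs \<le> b \<and> set Vs \<subseteq> gates g n \<and> U = foldr (*) Vs (1\<^sub>m (2 ^ n))}"

text \<open>
  Concatenating the \<open>m\<close>-digit vector \<open>c\<close> with the \<open>(n-m)\<close>-digit vector \<open>c'\<close> gives the basis index
  \<open>c + 2\<^sup>m c'\<close>, because the first qubit carries the least significant digit.
\<close>

definition Prob :: "nat \<Rightarrow> nat \<Rightarrow> complex Matrix.vec \<Rightarrow> nat \<Rightarrow> real" where
  "Prob m n x = (\<lambda>c\<in>{..<2 ^ m}. \<Sum>c'<2 ^ (n - m). (cmod (x $ (c + 2 ^ m * c')))\<^sup>2)"

definition phi :: "nat \<Rightarrow> nat \<Rightarrow> nat \<Rightarrow> complex mat \<Rightarrow> nat \<Rightarrow> nat \<Rightarrow> real" where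
  "phi m n k U = (\<lambda>j\<in>{..<k}. Prob m n (U *\<^sub>v unit_vec (2 ^ n) j))"

text \<open>
  \<^term>\<open>X_set b g m n N d k\<close> is a closed set, since the circuits form a compact set and \<^term>\<open>phi m n k\<close> is
  continuous. Hence it is measurable with respect to \<^term>\<open>tuple_unif k N (2 ^ m)\<close>.
\<close>

definition X_set :: "nat \<Rightarrow> nat \<Rightarrow> nat \<Rightarrow> nat \<Rightarrow> nat \<Rightarrow> real \<Rightarrow> nat \<Rightarrow> (nat \<Rightarrow> nat \<Rightarrow> real) set" where
  "X_set b g m n N d k =
     {x \<in> {..<k} \<rightarrow>\<^sub>E sparse_simplex N (2 ^ m).
        \<exists>U \<in> circuits g b n. avg_tvd k (2 ^ m) x (phi m n k U) \<le> d}"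

text \<open>The library's \<^term>\<open>ln 0 :: real\<close> is \<open>0\<close>, which would be wrong here.\<close>

definition eln :: "real \<Rightarrow> ereal" where
  "eln p = (if p = 0 then - \<infinity> else ereal (ln p))"


section \<open>The measures above are probability measures\<close>

lemma corner_simplex_eq:
  "corner_simplex T =
     {x. (\<forall>i\<in>T. 0 \<le> x i) \<and> sum x T \<le> 1} \<inter> space (\<Pi>\<^sub>M i\<in>T. (lborel :: real measure))"
  by (auto simp: corner_simplex_def space_PiM PiE_def)

lemma corner_simplex_measurable:
  assumes "finite T"
  shows "corner_simplex T \<in> sets (\<Pi>\<^sub>M i\<in>T. lborel)"
proof -
  have "corner_simplex T =
      Pi\<^sub>E T (\<lambda>_. {0..}) \<inter> (\<lambda>x. sum x T) -` {..1} \<inter> space (\<Pi>\<^sub>M i\<in>T. (lborel :: real measure))"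
    by (auto simp: corner_simplex_def space_PiM PiE_def)
  also have "\<dots> \<in> sets (\<Pi>\<^sub>M i\<in>T. lborel)"
    using assms by measurable
  finally show ?thesis .
qed

lemma emeasure_corner_simplex:
  assumes "finite T"
  shows "emeasure (\<Pi>\<^sub>M i\<in>T. lborel) (corner_simplex T) = ennreal (1 / fact (card T))"
  unfolding corner_simplex_eq
  using emeasure_std_simplex_aux[OF assms, of 1]
  by (simp add: ennreal_fact flip: divide_ennreal)

lemma face_lift_measurable:
  assumes "finite S"
  shows "face_lift S D \<in> (\<Pi>\<^sub>M i\<in>S - {Max S}. lborel) \<rightarrow>\<^sub>M (\<Pi>\<^sub>M i\<in>{..<D}. borel)"
  unfolding face_lift_def
proof (rule measurable_restrict)
  fix i
  have "(\<lambda>y. y i) \<in> borel_measurable (\<Pi>\<^sub>M i\<in>S - {Max S}. lborel)" if "i \<in> S - {Max S}"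
    using measurable_component_singleton[OF that, of "\<lambda>_. lborel"] by simp
  moreover have "(\<lambda>y. \<Sum>l\<in>S - {Max S}. y l) \<in> borel_measurable (\<Pi>\<^sub>M i\<in>S - {Max S}. lborel)"
  proof (rule borel_measurable_sum)
    fix l assume "l \<in> S - {Max S}"
    from measurable_component_singleton[OF this, of "\<lambda>_. lborel"]
    show "(\<lambda>y. y l) \<in> borel_measurable (\<Pi>\<^sub>M i\<in>S - {Max S}. lborel)" by simp
  qed
  ultimately show "(\<lambda>y. if i \<in> S - {Max S} then y i
      else if i = Max S then 1 - (\<Sum>l\<in>S - {Max S}. y l) else 0)
      \<in> borel_measurable (\<Pi>\<^sub>M i\<in>S - {Max S}. lborel)"
    by (cases "i \<in> S - {Max S}"; cases "i = Max S") auto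
qed

lemma prob_space_face_unif:
  assumes "finite S"
  shows "prob_space (face_unif S D)"
  unfolding face_unif_def
proof (rule prob_space.prob_space_distr)
  show "prob_space (uniform_measure (\<Pi>\<^sub>M i\<in>S - {Max S}. lborel) (corner_simplex (S - {Max S})))"
    using assms by (intro prob_space_uniform_measure) (simp_all add: emeasure_corner_simplex)
qed (use assms face_lift_measurable in simp)

lemma face_unif_kernel:
  "(\<lambda>S. face_unif S D) \<in> uniform_count_measure {S. S \<subseteq> {..<D} \<and> card S = N}
     \<rightarrow>\<^sub>M subprob_algebra (\<Pi>\<^sub>M i\<in>{..<D}. borel)"
proof -
  have "face_unif S D \<in> space (subprob_algebra (\<Pi>\<^sub>M i\<in>{..<D}. borel))" if "S \<subseteq> {..<D}" for S
    using prob_space_imp_subprob_space[OF prob_space_face_unif] finite_subset[OF that]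
    by (auto simp: space_subprob_algebra face_unif_def)
  thus ?thesis
    by (auto simp: measurable_def space_uniform_count_measure sets_uniform_count_measure)
qed

lemma prob_space_sparse_unif:
  assumes "N \<le> D"
  shows "prob_space (sparse_unif N D)"
  unfolding sparse_unif_def
proof (rule prob_space.prob_space_bind[OF _ _ face_unif_kernel])
  have "{..<N} \<in> {S. S \<subseteq> {..<D} \<and> card S = N}" using assms by simp
  hence "{S. S \<subseteq> {..<D} \<and> card S = N} \<noteq> {}" by blast
  thus "prob_space (uniform_count_measure {S. S \<subseteq> {..<D} \<and> card S = N})"
    by (intro prob_space_uniform_count_measure) auto
  show "AE S in uniform_count_measure {S. S \<subseteq> {..<D} \<and> card S = N}. prob_space (face_unif S D)"
    by (auto intro!: AE_I2 prob_space_face_unif finite_subset[OF _ finite_lessThan]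
             simp: space_uniform_count_measure)
qed

lemma prob_space_tuple_unif: "N \<le> D \<Longrightarrow> prob_space (tuple_unif k N D)"
  unfolding tuple_unif_def by (intro prob_space_PiM prob_space_sparse_unif)

lemma sets_sparse_unif:
  assumes "N \<le> D"
  shows "sets (sparse_unif N D) = sets (\<Pi>\<^sub>M i\<in>{..<D}. borel)"
proof -
  have "{..<N} \<in> {S. S \<subseteq> {..<D} \<and> card S = N}" using assms by simp
  hence "{S. S \<subseteq> {..<D} \<and> card S = N} \<noteq> {}" by blast
  hence "space (uniform_count_measure {S. S \<subseteq> {..<D} \<and> card S = N}) \<noteq> {}"
    by (auto simp: space_uniform_count_measure)
  thus ?thesis
    unfolding sparse_unif_def by (intro sets_bind) (auto simp: face_unif_def)
qed

end

theory Submission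
  imports Defs
begin

text \<open>
  Write \<open>W(x, y) = \<Sum>\<^sub>i min (x\<^sub>i) (y\<^sub>i)\<close> for the overlap of two distributions; their total variation
  distance is \<open>2 - 2 W(x, y)\<close>. A tuple within \<open>2 - \<epsilon>\<close> of a circuit output therefore has average
  overlap at least \<open>\<epsilon>/2\<close> with it, and still at least \<open>\<epsilon>/4\<close> with the output of the nearest circuit
  in a fine net. The net is obtained by rounding the entries of all gates, and the logarithm of its size
  is at most \<open>2\<^bsup>7g\<^esup> b ln (2b/\<epsilon>)\<close>.

  For a fixed \<open>y\<close> the overlap is controlled by its exponential moment
  \<open>E exp (N/4 W(x, y)) \<le> exp (8 N \<gamma>\<^bsup>1/2\<^esup>)\<close>, and Markov's inequality for the product measure gives
  the bound. Coordinates with \<open>y\<^sub>i \<le> \<gamma>\<^bsup>1/2\<^esup>/N\<close> contribute at most \<open>\<gamma>\<^bsup>1/2\<^esup>\<close> to the overlap.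
  There are at most \<open>N \<gamma>\<^bsup>-1/2\<^esup>\<close> others; each of them lies in the random support with probability \<open>\<gamma>\<close>,
  and each one in the support costs a constant factor, since the coordinates of a uniform point of
  a simplex have jointly exponential tails on the scale \<open>1/N\<close>.
\<close>

section \<open>Exponential moments of the overlap\<close>

text \<open>Both measures are determined by their values on boxes, where the claim is the
  translation invariance of \<open>lborel\<close> in each coordinate.\<close>

lemma distr_PiM_lborel_translate:
  assumes "finite T"
  shows "distr (\<Pi>\<^sub>M i\<in>T. lborel) (\<Pi>\<^sub>M i\<in>T. lborel) (\<lambda>y. \<lambda>i\<in>T. y i + u i) = (\<Pi>\<^sub>M i\<in>T. (lborel :: real measure))"
proof -
  interpret product_sigma_finite "\<lambda>_. lborel :: real measure"
    by standard
  have meas: "(\<lambda>y. \<lambda>i\<in>T. y i + u i) \<in> (\<Pi>\<^sub>M i\<in>T. lborel) \<rightarrow>\<^sub>M (\<Pi>\<^sub>M i\<in>T. (lborel :: real measure))"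
    by measurable
  show ?thesis
  proof (rule PiM_eqI[OF assms])
    fix A :: "'a \<Rightarrow> real set" assume A: "\<And>i. i \<in> T \<Longrightarrow> A i \<in> sets lborel"
    have shift: "(\<lambda>x. x + u i) -` A i \<in> sets lborel" if "i \<in> T" for i
    proof -
      have "(\<lambda>x. x + u i) -` A i \<inter> space lborel \<in> sets lborel"
        by (rule measurable_sets[OF _ A[OF that]]) simp
      thus ?thesis by simp
    qed
    have "emeasure (distr (\<Pi>\<^sub>M i\<in>T. lborel) (\<Pi>\<^sub>M i\<in>T. lborel) (\<lambda>y. \<lambda>i\<in>T. y i + u i)) (Pi\<^sub>E T A)
        = emeasure (\<Pi>\<^sub>M i\<in>T. lborel) (Pi\<^sub>E T (\<lambda>i. (\<lambda>x. x + u i) -` A i))"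
      using A assms by (subst emeasure_distr[OF meas])
        (auto intro!: sets_PiM_I_finite arg_cong2[where f = emeasure] simp: space_PiM PiE_iff)
    also have "\<dots> = (\<Prod>i\<in>T. emeasure lborel ((\<lambda>x. x + u i) -` A i))"
      using shift assms by (subst emeasure_PiM) auto
    also have "\<dots> = (\<Prod>i\<in>T. emeasure lborel (A i))"
    proof (rule prod.cong[OF refl])
      fix i assume i: "i \<in> T"
      have "emeasure lborel (A i) = emeasure (distr lborel borel ((+) (u i))) (A i)"
        by (simp add: lborel_distr_plus)
      also have "\<dots> = emeasure lborel ((+) (u i) -` A i \<inter> space lborel)"
        using A[OF i] by (intro emeasure_distr) auto
      finally show "emeasure lborel ((\<lambda>x. x + u i) -` A i) = emeasure lborel (A i)"
        by (simp add: vimage_def add.commute)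
    qed
    finally show "emeasure (distr (\<Pi>\<^sub>M i\<in>T. lborel) (\<Pi>\<^sub>M i\<in>T. lborel) (\<lambda>y. \<lambda>i\<in>T. y i + u i)) (Pi\<^sub>E T A)
        = (\<Prod>i\<in>T. emeasure lborel (A i))" .
  qed simp
qed

text \<open>Translation by \<open>u\<close> carries the simplex of size \<open>t\<close> with corner
  at the origin onto this set, so its volume is that of the standard simplex.\<close>

lemma emeasure_translated_simplex:
  fixes u :: "'a \<Rightarrow> real"
  assumes "finite T" "0 \<le> t"
  shows "emeasure (\<Pi>\<^sub>M i\<in>T. lborel)
      ({y. (\<forall>i\<in>T. u i \<le> y i) \<and> sum y T \<le> t + sum u T} \<inter> space (\<Pi>\<^sub>M i\<in>T. (lborel :: real measure)))
    = ennreal (t ^ card T / fact (card T))"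
proof -
  let ?M = "\<Pi>\<^sub>M i\<in>T. (lborel :: real measure)"
  let ?A = "{y. (\<forall>i\<in>T. u i \<le> y i) \<and> sum y T \<le> t + sum u T} \<inter> space ?M"
  have "?A = Pi\<^sub>E T (\<lambda>i. {u i..}) \<inter> (\<lambda>x. sum x T) -` {..t + sum u T} \<inter> space ?M"
    by (auto simp: space_PiM PiE_def)
  also have "\<dots> \<in> sets ?M"
    using assms by measurable
  finally have A: "?A \<in> sets ?M" .
  have meas: "(\<lambda>y. \<lambda>i\<in>T. y i + u i) \<in> ?M \<rightarrow>\<^sub>M ?M"
    by measurable
  have "emeasure ?M ?A = emeasure (distr ?M ?M (\<lambda>y. \<lambda>i\<in>T. y i + u i)) ?A"
    by (simp add: distr_PiM_lborel_translate[OF assms(1)])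
  also have "\<dots> = emeasure ?M ((\<lambda>y. \<lambda>i\<in>T. y i + u i) -` ?A \<inter> space ?M)"
    by (rule emeasure_distr[OF meas A])
  also have "(\<lambda>y. \<lambda>i\<in>T. y i + u i) -` ?A \<inter> space ?M
      = {y. (\<forall>i\<in>T. 0 \<le> y i) \<and> sum y T \<le> t} \<inter> space ?M"
    by (auto simp: space_PiM sum.distrib)
  also have "emeasure ?M \<dots> = ennreal (t ^ card T / fact (card T))"
    using emeasure_std_simplex_aux[OF assms] assms(2)
    by (simp add: ennreal_power flip: divide_ennreal ennreal_fact)
  finally show ?thesis .
qed

section \<open>The uniform law on one face\<close>

lemma face_lift_sum:
  assumes "finite S" "S \<subseteq> {..<D}" "S \<noteq> {}"
  shows "(\<Sum>i\<in>S. face_lift S D y i) = 1"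
proof -
  have "(\<Sum>i\<in>S. face_lift S D y i)
      = face_lift S D y (Max S) + (\<Sum>i\<in>S - {Max S}. face_lift S D y i)"
    using assms by (intro sum.remove) auto
  also have "(\<Sum>i\<in>S - {Max S}. face_lift S D y i) = (\<Sum>i\<in>S - {Max S}. y i)"
    using assms by (intro sum.cong) (auto simp: face_lift_def)
  also have "face_lift S D y (Max S) = 1 - (\<Sum>i\<in>S - {Max S}. y i)"
    using assms Max_in[of S] by (auto simp: face_lift_def)
  finally show ?thesis by simp
qed

text \<open>The law is carried by the lifted corner simplex. The upper bound follows from
  nonnegative coordinates with sum one; it caps the levels at \<open>N\<close> when coordinates are
  rounded later.\<close>

lemma AE_face_unif:
  assumes "finite S" "S \<subseteq> {..<D}" "S \<noteq> {}"
  shows "AE x in face_unif S D.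
    (\<forall>i\<in>{..<D}. 0 \<le> x i) \<and> (\<forall>i\<in>{..<D} - S. x i = 0) \<and> (\<forall>i\<in>S. x i \<le> 1)"
proof -
  let ?T = "S - {Max S}"
  let ?P = "\<lambda>x. (\<forall>i\<in>{..<D}. 0 \<le> x i) \<and> (\<forall>i\<in>{..<D} - S. x i = 0) \<and> (\<forall>i\<in>S. x i \<le> (1::real))"
  have P: "?P (face_lift S D y)" if "y \<in> corner_simplex ?T" for y
  proof -
    from that have y: "\<And>i. i \<in> ?T \<Longrightarrow> 0 \<le> y i" "(\<Sum>i\<in>?T. y i) \<le> 1"
      by (auto simp: corner_simplex_def)
    have nn: "\<forall>i\<in>{..<D}. 0 \<le> face_lift S D y i"
      using y by (simp add: face_lift_def)
    moreover have "\<forall>i\<in>{..<D} - S. face_lift S D y i = 0"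
    proof
      fix i assume "i \<in> {..<D} - S"
      moreover from this have "i \<noteq> Max S" using Max_in[OF assms(1,3)] by blast
      ultimately show "face_lift S D y i = 0" by (simp add: face_lift_def)
    qed
    moreover have "face_lift S D y i \<le> 1" if "i \<in> S" for i
      unfolding face_lift_sum[OF assms, of y, symmetric] using that nn assms
      by (intro member_le_sum) auto
    ultimately show ?thesis by auto
  qed
  have ae: "AE y in uniform_measure (\<Pi>\<^sub>M i\<in>?T. lborel) (corner_simplex ?T). ?P (face_lift S D y)"
    using assms(1) by (intro AE_uniform_measureI corner_simplex_measurable AE_I2 impI P) simp
  have meas: "face_lift S D \<in> uniform_measure (\<Pi>\<^sub>M i\<in>?T. lborel) (corner_simplex ?T)
      \<rightarrow>\<^sub>M (\<Pi>\<^sub>M i\<in>{..<D}. borel)"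
    using face_lift_measurable[OF assms(1)] by simp
  have "{x \<in> space (\<Pi>\<^sub>M i\<in>{..<D}. (borel :: real measure)). ?P x} \<in> sets (\<Pi>\<^sub>M i\<in>{..<D}. borel)"
  proof -
    have "S \<inter> {..<D} = S" using assms by auto
    have [measurable]: "(\<lambda>x. x i) \<in> borel_measurable (\<Pi>\<^sub>M i\<in>{..<D}. (borel :: real measure))" if "i \<in> S" for i
      using that assms by (intro measurable_component_singleton) auto
    show ?thesis using assms(1) by measurable
  qed
  thus ?thesis
    unfolding face_unif_def using ae by (subst AE_distr_iff[OF meas])
qed

text \<open>
  Lower bounds on the barycentric coordinates cut a similar simplex out of the face, scaled by the
  factor \<open>1 - sum u J\<close>.
\<close>

lemma emeasure_face_unif_above_le:
  assumes "finite S" "S \<subseteq> {..<D}" "S \<noteq> {}" "J \<subseteq> S" and u: "\<And>i. i \<in> J \<Longrightarrow> 0 \<le> u i"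
  shows "emeasure (face_unif S D) {x \<in> space (\<Pi>\<^sub>M i\<in>{..<D}. borel). \<forall>i\<in>J. u i \<le> x i}
    \<le> ennreal (exp (- (real (card S - 1) * sum u J)))"
proof -
  define T where "T = S - {Max S}"
  let ?M = "\<Pi>\<^sub>M i\<in>T. (lborel :: real measure)"
  \<comment> \<open>Extending \<open>u\<close> by zero to \<open>S\<close> treats the free
    coordinates and the dependent coordinate \<open>Max S\<close> alike, whether or not they lie in
    \<open>J\<close>.\<close>
  define w where "w i = (if i \<in> J then u i else 0)" for i
  define t where "t = 1 - sum w S"
  have "finite T" "Max S \<in> S" and cardT: "card T = card S - 1"
    using assms by (auto simp: T_def)
  have sum_w: "sum w S = sum u J"
    using assms by (simp add: w_def sum.If_cases Int_absorb1)
  have sum_S: "sum f S = f (Max S) + sum f T" for f :: "nat \<Rightarrow> real"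
    unfolding T_def using assms by (intro sum.remove) auto
  let ?B = "{x \<in> space (\<Pi>\<^sub>M i\<in>{..<D}. (borel :: real measure)). \<forall>i\<in>J. u i \<le> x i}"
  have B: "?B \<in> sets (\<Pi>\<^sub>M i\<in>{..<D}. borel)"
  proof -
    have [measurable]: "(\<lambda>x. x i) \<in> borel_measurable (\<Pi>\<^sub>M i\<in>{..<D}. (borel :: real measure))" if "i \<in> J" for i
      using that assms by (intro measurable_component_singleton) auto
    have "finite J" using finite_subset[OF assms(4,1)] .
    thus ?thesis by measurable
  qed
  have pre: "w i \<le> face_lift S D y i" "face_lift S D y i = (if i = Max S then 1 - sum y T else y i)"
    if "y \<in> corner_simplex T" "face_lift S D y \<in> ?B" "i \<in> S" for y i
  proof -
    show eq: "face_lift S D y i = (if i = Max S then 1 - sum y T else y i)"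
      using that assms by (auto simp: face_lift_def T_def)
    have "0 \<le> face_lift S D y i"
      unfolding eq using that by (auto simp: corner_simplex_def T_def)
    thus "w i \<le> face_lift S D y i"
      using that by (auto simp: w_def)
  qed
  have le: "emeasure ?M (corner_simplex T \<inter> (face_lift S D -` ?B \<inter> space ?M))
    \<le> ennreal (exp (- (real (card S - 1) * sum u J)) / fact (card T))"
  proof (cases "t \<ge> 0")
    case True
    have "corner_simplex T \<inter> (face_lift S D -` ?B \<inter> space ?M)
        \<subseteq> {y. (\<forall>i\<in>T. w i \<le> y i) \<and> sum y T \<le> t + sum w T} \<inter> space ?M"
    proof
      fix y assume y: "y \<in> corner_simplex T \<inter> (face_lift S D -` ?B \<inter> space ?M)"
      have "w i \<le> y i" if "i \<in> T" for i
        using pre[of y i] y that by (auto simp: T_def)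
      \<comment> \<open>The lower bound on the dependent coordinate becomes the upper bound on
        \<open>sum y T\<close>, because \<open>t + sum w T\<close> equals
        \<open>1 - w (Max S)\<close>.\<close>
      moreover have "w (Max S) \<le> 1 - sum y T"
        using pre[of y "Max S"] y \<open>Max S \<in> S\<close> by auto
      ultimately show "y \<in> {y. (\<forall>i\<in>T. w i \<le> y i) \<and> sum y T \<le> t + sum w T} \<inter> space ?M"
        using y by (auto simp: t_def sum_S)
    qed
    hence "emeasure ?M (corner_simplex T \<inter> (face_lift S D -` ?B \<inter> space ?M))
        \<le> emeasure ?M ({y. (\<forall>i\<in>T. w i \<le> y i) \<and> sum y T \<le> t + sum w T} \<inter> space ?M)"
    proof (rule emeasure_mono)
      have "{y. (\<forall>i\<in>T. w i \<le> y i) \<and> sum y T \<le> t + sum w T} \<inter> space ?M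
        = Pi\<^sub>E T (\<lambda>i. {w i..}) \<inter> (\<lambda>x. sum x T) -` {..t + sum w T} \<inter> space ?M"
        by (auto simp: space_PiM PiE_def)
      also have "\<dots> \<in> sets ?M"
        using \<open>finite T\<close> by measurable
      finally show "{y. (\<forall>i\<in>T. w i \<le> y i) \<and> sum y T \<le> t + sum w T} \<inter> space ?M \<in> sets ?M" .
    qed
    also have "\<dots> = ennreal (t ^ card T / fact (card T))"
      by (rule emeasure_translated_simplex[OF \<open>finite T\<close> True])
    \<comment> \<open>The inequality \<open>1 - s <= exp (- s)\<close>, raised to the dimension of
      the face.\<close>
    also have "t ^ card T \<le> exp (- sum u J) ^ card T"
      using True exp_ge_add_one_self[of "- sum u J"] by (intro power_mono) (auto simp: t_def sum_w)
    hence "t ^ card T / fact (card T) \<le> exp (- (real (card S - 1) * sum u J)) / fact (card T)"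
      by (intro divide_right_mono) (auto simp: cardT exp_of_nat_mult[symmetric] algebra_simps)
    finally show ?thesis by (simp add: ennreal_leI)
  next
    case False
    \<comment> \<open>For negative \<open>t\<close> the prescribed lower bounds add up to more than
      one, so the event is empty.\<close>
    have "False" if y: "y \<in> corner_simplex T" "face_lift S D y \<in> ?B" for y
    proof -
      have "sum w S \<le> sum (face_lift S D y) S"
        using pre[OF y] by (intro sum_mono) auto
      also have "\<dots> = 1" using face_lift_sum assms by blast
      finally show False using False by (simp add: t_def)
    qed
    hence "corner_simplex T \<inter> (face_lift S D -` ?B \<inter> space ?M) = {}" by blast
    thus ?thesis by simp
  qed
  have "emeasure (face_unif S D) ?B
      = emeasure (uniform_measure ?M (corner_simplex T)) (face_lift S D -` ?B \<inter> space ?M)"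
    unfolding face_unif_def T_def
    by (subst emeasure_distr) (use assms B face_lift_measurable in auto)
  also have "\<dots> = emeasure ?M (corner_simplex T \<inter> (face_lift S D -` ?B \<inter> space ?M))
      / emeasure ?M (corner_simplex T)"
    using \<open>finite T\<close> corner_simplex_measurable[OF \<open>finite T\<close>]
      measurable_sets[OF face_lift_measurable[OF assms(1)] B]
    by (intro emeasure_uniform_measure) (auto simp: T_def)
  also have "\<dots> \<le> ennreal (exp (- (real (card S - 1) * sum u J)) / fact (card T))
      / ennreal (1 / fact (card T))"
    unfolding emeasure_corner_simplex[OF \<open>finite T\<close>]
    by (rule divide_right_mono_ennreal[OF le])
  also have "\<dots> = ennreal (exp (- (real (card S - 1) * sum u J)))"
    by (subst divide_ennreal) auto
  finally show ?thesis .
qed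

section \<open>Exponential moments on one face\<close>

text \<open>A geometric series whose ratio is at most \<open>4 / 5\<close>, because
  \<open>exp (1 / 4) >= 5 / 4\<close>; the infinite series with ratio \<open>4 / 5\<close> has sum
  5.\<close>

lemma sum_exp_neg_quarter_le: "(\<Sum>v\<le>n. exp (- real v / 4)) \<le> 5"
proof -
  have "exp (- (1 / 4 :: real)) \<le> 4 / 5"
    using exp_ge_add_one_self[of "1/4::real"] by (simp add: exp_minus field_simps)
  have "(\<Sum>v\<le>n. exp (- real v / 4)) = (\<Sum>v\<le>n. exp (- (1 / 4)) ^ v)"
    by (simp add: exp_of_nat_mult[symmetric] algebra_simps)
  also have "\<dots> \<le> (\<Sum>v\<le>n. (4 / 5) ^ v)"
    using \<open>exp (- (1 / 4 :: real)) \<le> 4 / 5\<close> by (intro sum_mono power_mono) auto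
  also have "\<dots> \<le> 5"
    by (simp add: sum_gp0)
  finally show ?thesis .
qed

text \<open>The quadratic Taylor bound gives \<open>21 / 16\<close>. The looser \<open>8 / 5\<close>
  combines with the bound 5 on the geometric sum to the round constant 8.\<close>

lemma exp_quarter_le: "exp (1 / 4 :: real) \<le> 8 / 5"
proof -
  have "exp (1 / 4 :: real) \<le> 1 + 1 / 4 + (1 / 4)\<^sup>2"
    by (rule exp_bound) auto
  thus ?thesis by (simp add: power2_eq_square)
qed

text \<open>
  Rounding \<open>x\<close> down to a multiple of \<open>1/N\<close> turns exponential moments into finite sums of
  probabilities of joint tail events.
\<close>

lemma exp_le_sum_levels:
  assumes "0 < N" "0 \<le> x" "x \<le> (1::real)"
  shows "exp (real N / 4 * x)
    \<le> (\<Sum>v\<le>N. 8 / 5 * exp (real v / 4) * of_bool (real v / real N \<le> x))"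
proof -
  define z where "z = nat \<lfloor>real N * x\<rfloor>"
  have z: "real z \<le> real N * x" "real N * x < real z + 1"
    using assms by (auto simp: z_def)
  have "z \<le> N"
  proof -
    have "real z \<le> real N * 1" using z(1) mult_left_mono[OF assms(3), of "real N"] by linarith
    thus ?thesis by simp
  qed
  \<comment> \<open>Rounding costs a factor \<open>exp (1 / 4)\<close>, as \<open>N * x\<close>
    exceeds \<open>z\<close> by less than one. The term with index \<open>z\<close> alone then
    dominates the left side.\<close>
  have "exp (real N / 4 * x) \<le> exp (1 / 4 + real z / 4)"
    using z by simp
  also have "\<dots> \<le> 8 / 5 * exp (real z / 4)"
    using exp_quarter_le by (simp add: exp_add)
  also have "\<dots> = 8 / 5 * exp (real z / 4) * of_bool (real z / real N \<le> x)"
    using z assms by (simp add: field_simps)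
  also have "\<dots> \<le> (\<Sum>v\<le>N. 8 / 5 * exp (real v / 4) * of_bool (real v / real N \<le> x))"
    using \<open>z \<le> N\<close>
    by (intro member_le_sum[of z "{..N}" "\<lambda>v. 8 / 5 * exp (real v / 4) * of_bool (real v / real N \<le> x)"]) auto
  finally show ?thesis .
qed

text \<open>After rounding, a vector \<open>v\<close> of levels has weight
  \<open>exp (v i / 4)\<close> in each coordinate, up to the rounding factor, while its joint tail
  probability is at most the product of the \<open>exp (- v i / 2)\<close>. What remains is a
  product of convergent geometric sums, one factor 8 for each coordinate in
  \<open>J\<close>.\<close>

lemma face_unif_mgf_le:
  assumes S: "finite S" "S \<subseteq> {..<D}" "2 \<le> card S" and J: "J \<subseteq> S"
  shows "(\<integral>\<^sup>+x. ennreal (exp (real (card S) / 4 * (\<Sum>i\<in>J. x i))) \<partial>face_unif S D) \<le> ennreal (8 ^ card J)"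
proof -
  define N where "N = card S"
  have N: "2 \<le> N" using S by (simp add: N_def)
  have "S \<noteq> {}" and fJ: "finite J" using S J by (auto intro: finite_subset)
  have J_D: "i < D" if "i \<in> J" for i using that S J by auto
  let ?B = "\<lambda>v. {x \<in> space (\<Pi>\<^sub>M i\<in>{..<D}. borel). \<forall>i\<in>J. real (v i) / real N \<le> x i}"
  let ?c = "\<lambda>v::nat. 8 / 5 * exp (real v / 4)"
  have [measurable_cong]: "sets (face_unif S D) = sets (\<Pi>\<^sub>M i\<in>{..<D}. borel)"
    by (simp add: face_unif_def)
  have B: "?B v \<in> sets (face_unif S D)" for v
  proof -
    have [measurable]: "(\<lambda>x. x i) \<in> borel_measurable (\<Pi>\<^sub>M i\<in>{..<D}. (borel :: real measure))" if "i \<in> J" for i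
      using J_D[OF that] by (intro measurable_component_singleton) auto
    have "?B v \<in> sets (\<Pi>\<^sub>M i\<in>{..<D}. borel)"
      using fJ by measurable
    thus ?thesis by (simp add: face_unif_def)
  qed
  have pt: "exp (real N / 4 * (\<Sum>i\<in>J. x i))
      \<le> (\<Sum>v\<in>J \<rightarrow>\<^sub>E {..N}. (\<Prod>i\<in>J. ?c (v i)) * indicator (?B v) x)"
    if "x \<in> space (\<Pi>\<^sub>M i\<in>{..<D}. borel)" "\<forall>i\<in>{..<D}. 0 \<le> x i" "\<forall>i\<in>S. x i \<le> 1" for x
  proof -
    have "exp (real N / 4 * (\<Sum>i\<in>J. x i)) = (\<Prod>i\<in>J. exp (real N / 4 * x i))"
      using fJ by (simp add: sum_distrib_left exp_sum)
    also have "\<dots> \<le> (\<Prod>i\<in>J. \<Sum>v\<le>N. ?c v * of_bool (real v / real N \<le> x i))"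
      using that N J J_D by (intro prod_mono conjI exp_le_sum_levels) auto
    \<comment> \<open>Distributivity turns the product of sums into a sum over level vectors, each
      of which belongs to one joint tail event.\<close>
    also have "\<dots> = (\<Sum>v\<in>J \<rightarrow>\<^sub>E {..N}. \<Prod>i\<in>J. ?c (v i) * of_bool (real (v i) / real N \<le> x i))"
      using fJ by (subst prod_sum_PiE) auto
    also have "\<dots> = (\<Sum>v\<in>J \<rightarrow>\<^sub>E {..N}. (\<Prod>i\<in>J. ?c (v i)) * indicator (?B v) x)"
    proof (rule sum.cong[OF refl])
      fix v
      have "(\<Prod>i\<in>J. of_bool (real (v i) / real N \<le> x i)) = (indicator (?B v) x :: real)"
        using that(1) fJ by (auto simp: indicator_def)
      thus "(\<Prod>i\<in>J. ?c (v i) * of_bool (real (v i) / real N \<le> x i))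
          = (\<Prod>i\<in>J. ?c (v i)) * indicator (?B v) x"
        by (simp only: prod.distrib)
    qed
    finally show ?thesis .
  qed
  have "(\<integral>\<^sup>+x. ennreal (exp (real N / 4 * (\<Sum>i\<in>J. x i))) \<partial>face_unif S D)
      \<le> (\<integral>\<^sup>+x. (\<Sum>v\<in>J \<rightarrow>\<^sub>E {..N}. ennreal (\<Prod>i\<in>J. ?c (v i)) * indicator (?B v) x) \<partial>face_unif S D)"
  proof (rule nn_integral_mono_AE)
    show "AE x in face_unif S D. ennreal (exp (real N / 4 * (\<Sum>i\<in>J. x i)))
        \<le> (\<Sum>v\<in>J \<rightarrow>\<^sub>E {..N}. ennreal (\<Prod>i\<in>J. ?c (v i)) * indicator (?B v) x)"
      using AE_face_unif[OF S(1,2) \<open>S \<noteq> {}\<close>] AE_space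
    proof eventually_elim
      case (elim x)
      hence "x \<in> space (\<Pi>\<^sub>M i\<in>{..<D}. borel)" by (simp add: face_unif_def)
      from pt[OF this] elim have "ennreal (exp (real N / 4 * (\<Sum>i\<in>J. x i)))
          \<le> ennreal (\<Sum>v\<in>J \<rightarrow>\<^sub>E {..N}. (\<Prod>i\<in>J. ?c (v i)) * indicator (?B v) x)"
        by (intro ennreal_leI) auto
      also have "\<dots> = (\<Sum>v\<in>J \<rightarrow>\<^sub>E {..N}. ennreal (\<Prod>i\<in>J. ?c (v i)) * indicator (?B v) x)"
        by (subst sum_ennreal[symmetric])
           (auto intro!: prod_nonneg mult_nonneg_nonneg sum.cong simp: ennreal_mult' indicator_def)
      finally show ?case .
    qed
  qed
  also have "\<dots> = (\<Sum>v\<in>J \<rightarrow>\<^sub>E {..N}. ennreal (\<Prod>i\<in>J. ?c (v i)) * emeasure (face_unif S D) (?B v))"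
    using B by (subst nn_integral_sum) (auto intro!: sum.cong nn_integral_cmult_indicator)
  also have "\<dots> \<le> (\<Sum>v\<in>J \<rightarrow>\<^sub>E {..N}. ennreal (\<Prod>i\<in>J. 8 / 5 * exp (- real (v i) / 4)))"
  proof (rule sum_mono)
    fix v
    \<comment> \<open>The tail exponent contains the dimension \<open>N - 1\<close> of the face;
      \<open>N >= 2\<close> makes it at least half of \<open>N\<close>.\<close>
    have half: "real N / 2 \<le> real (N - 1)" using N by auto
    have "emeasure (face_unif S D) (?B v)
        \<le> ennreal (exp (- (real (N - 1) * (\<Sum>i\<in>J. real (v i) / real N))))"
      unfolding N_def using S J \<open>S \<noteq> {}\<close> by (intro emeasure_face_unif_above_le) auto
    also have "\<dots> \<le> ennreal (exp (- (real N / 2 * (\<Sum>i\<in>J. real (v i) / real N))))"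
      by (intro ennreal_leI iffD2[OF exp_le_cancel_iff] le_imp_neg_le mult_right_mono[OF half] sum_nonneg) simp
    also have "exp (- (real N / 2 * (\<Sum>i\<in>J. real (v i) / real N))) = (\<Prod>i\<in>J. exp (- real (v i) / 2))"
      using fJ N by (simp add: sum_distrib_left exp_sum sum_negf[symmetric])
    finally have "ennreal (\<Prod>i\<in>J. ?c (v i)) * emeasure (face_unif S D) (?B v)
        \<le> ennreal (\<Prod>i\<in>J. ?c (v i)) * ennreal (\<Prod>i\<in>J. exp (- real (v i) / 2))"
      by (rule mult_left_mono) simp
    also have "\<dots> = ennreal (\<Prod>i\<in>J. ?c (v i) * exp (- real (v i) / 2))"
      unfolding prod.distrib by (rule ennreal_mult[symmetric]) (auto intro!: prod_nonneg mult_nonneg_nonneg)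
    also have "(\<Prod>i\<in>J. ?c (v i) * exp (- real (v i) / 2)) = (\<Prod>i\<in>J. 8 / 5 * exp (- real (v i) / 4))"
      by (intro prod.cong refl) (simp add: exp_add[symmetric])
    finally show "ennreal (\<Prod>i\<in>J. ?c (v i)) * emeasure (face_unif S D) (?B v)
        \<le> ennreal (\<Prod>i\<in>J. 8 / 5 * exp (- real (v i) / 4))" .
  qed
  \<comment> \<open>Distributivity read backwards separates the coordinates again.\<close>
  also have "\<dots> = ennreal (\<Prod>i\<in>J. \<Sum>v\<le>N. 8 / 5 * exp (- real v / 4))"
    using fJ by (subst prod_sum_PiE) (auto intro!: sum_ennreal prod_nonneg)
  also have "\<dots> \<le> ennreal (8 ^ card J)"
  proof (rule ennreal_leI)
    have "(\<Sum>v\<le>N. 8 / 5 * exp (- real v / 4)) \<le> 8"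
      using sum_exp_neg_quarter_le[of N] unfolding sum_distrib_left[symmetric] by linarith
    hence "(\<Prod>i\<in>J. \<Sum>v\<le>N. 8 / 5 * exp (- real v / 4)) \<le> (\<Prod>i\<in>J. 8)"
      by (intro prod_mono) (auto intro!: sum_nonneg)
    thus "(\<Prod>i\<in>J. \<Sum>v\<le>N. 8 / 5 * exp (- real v / 4)) \<le> 8 ^ card J" by simp
  qed
  finally show ?thesis by (simp add: N_def)
qed

section \<open>Averaging over the random support\<close>

text \<open>The quotient of the two binomials is the probability that a uniform
  \<open>N\<close>-subset contains \<open>r\<close> given points. It is a product of factors
  \<open>(N - i) / (D - i)\<close>, each at most \<open>N / D\<close>; the induction splits off one
  factor by the absorption identity.\<close>

lemma binomial_ratio_le:
  assumes "r \<le> N" "N \<le> D"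
  shows "real (D - r choose (N - r)) \<le> (real N / real D) ^ r * real (D choose N)"
  using assms
proof (induction r arbitrary: N D)
  case (Suc r)
  then obtain N' D' where eq: "N = Suc N'" "D = Suc D'" by (metis Suc_le_D le_trans)
  have le: "r \<le> N'" "N' \<le> D'" using Suc.prems eq by auto
  have "real N' / real D' \<le> real N / real D"
    using le by (cases "D' = 0") (auto simp: eq field_simps)
  have "real (D - Suc r choose (N - Suc r)) = real (D' - r choose (N' - r))"
    by (simp add: eq)
  also have "\<dots> \<le> (real N' / real D') ^ r * real (D' choose N')"
    by (rule Suc.IH[OF le])
  also have "\<dots> \<le> (real N / real D) ^ r * real (D' choose N')"
    using \<open>real N' / real D' \<le> real N / real D\<close> by (intro mult_right_mono power_mono) auto
  also have "real (D' choose N') = real N / real D * real (D choose N)"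
  proof -
    have "real (Suc D' * (D' choose N')) = real ((Suc D' choose Suc N') * Suc N')"
      by (simp only: Suc_times_binomial_eq)
    thus ?thesis by (simp add: eq field_simps del: binomial_Suc_Suc)
  qed
  finally show ?case by (simp add: mult_ac)
qed simp

lemma card_supersets:
  assumes "R \<subseteq> {..<D}" "card R \<le> N"
  shows "card {S. S \<subseteq> {..<D} \<and> card S = N \<and> R \<subseteq> S} = (D - card R choose (N - card R))"
proof -
  have fin: "finite R" using assms finite_subset by blast
  have "bij_betw (\<lambda>S. S - R) {S. S \<subseteq> {..<D} \<and> card S = N \<and> R \<subseteq> S}
      {S. S \<subseteq> {..<D} - R \<and> card S = N - card R}"
  proof (rule bij_betwI[where g = "\<lambda>S. S \<union> R"])
    show "(\<lambda>S. S \<union> R) \<in> {S. S \<subseteq> {..<D} - R \<and> card S = N - card R}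
        \<rightarrow> {S. S \<subseteq> {..<D} \<and> card S = N \<and> R \<subseteq> S}"
    proof
      fix S assume S: "S \<in> {S. S \<subseteq> {..<D} - R \<and> card S = N - card R}"
      hence "finite S" "S \<inter> R = {}" by (auto intro: finite_subset)
      with S fin assms show "S \<union> R \<in> {S. S \<subseteq> {..<D} \<and> card S = N \<and> R \<subseteq> S}"
        by (auto simp: card_Un_disjoint)
    qed
  qed (use assms fin in \<open>auto simp: card_Diff_subset\<close>)
  hence "card {S. S \<subseteq> {..<D} \<and> card S = N \<and> R \<subseteq> S} = card {S. S \<subseteq> {..<D} - R \<and> card S = N - card R}"
    by (rule bij_betw_same_card)
  also have "\<dots> = (D - card R choose (N - card R))"
    using assms fin by (subst n_subsets) (auto simp: card_Diff_subset)
  finally show ?thesis .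
qed

text \<open>The power of \<open>1 + a\<close> expands over the subsets \<open>R\<close> of
  \<open>S \<inter> A\<close>. Averaging over \<open>S\<close> replaces each condition
  \<open>R \<subseteq> S\<close> by at most the \<open>card R\<close>-th power of
  \<open>N / D\<close>, and the binomial theorem resums. Thus the support is dominated by
  independent inclusion of points with probability \<open>N / D\<close>.\<close>

lemma sum_power_card_inter_le:
  assumes "A \<subseteq> {..<D}" "N \<le> D" "0 \<le> a"
  shows "(\<Sum>S | S \<subseteq> {..<D} \<and> card S = N. (1 + a) ^ card (S \<inter> A))
    \<le> real (D choose N) * (1 + a * (real N / real D)) ^ card A"
proof -
  let ?F = "{S. S \<subseteq> {..<D} \<and> card S = N}"
  have fA: "finite A" using assms finite_subset by blast
  have finF: "finite ?F" by simp
  have "(1 + a) ^ card (S \<inter> A) = (\<Sum>R\<in>Pow A. a ^ card R * of_bool (R \<subseteq> S))" for S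
  proof -
    have "(1 + a) ^ card (S \<inter> A) = (\<Prod>i\<in>A. if i \<in> S then 1 + a else 1)"
      using fA by (simp add: prod.If_cases Int_commute)
    also have "\<dots> = (\<Prod>i\<in>A. a * of_bool (i \<in> S) + 1)"
      by (intro prod.cong) auto
    also have "\<dots> = (\<Sum>R\<in>Pow A. (\<Prod>i\<in>R. a * of_bool (i \<in> S)) * (\<Prod>i\<in>A - R. 1))"
      by (rule prod_add[OF fA])
    also have "\<dots> = (\<Sum>R\<in>Pow A. a ^ card R * of_bool (R \<subseteq> S))"
    proof (rule sum.cong[OF refl])
      fix R assume "R \<in> Pow A"
      hence "finite R" using fA finite_subset by auto
      hence "(\<Prod>i\<in>R. of_bool (i \<in> S)) = (of_bool (R \<subseteq> S) :: real)"
        by (auto intro!: prod.neutral)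
      thus "(\<Prod>i\<in>R. a * of_bool (i \<in> S)) * (\<Prod>i\<in>A - R. 1) = a ^ card R * of_bool (R \<subseteq> S)"
        by (simp add: prod.distrib)
    qed
    finally show ?thesis .
  qed
  hence "(\<Sum>S\<in>?F. (1 + a) ^ card (S \<inter> A)) = (\<Sum>R\<in>Pow A. a ^ card R * (\<Sum>S\<in>?F. of_bool (R \<subseteq> S)))"
    by (simp only: sum_distrib_left) (rule sum.swap)
  also have "\<dots> \<le> (\<Sum>R\<in>Pow A. a ^ card R * ((real N / real D) ^ card R * real (D choose N)))"
  proof (intro sum_mono mult_left_mono)
    fix R assume R: "R \<in> Pow A"
    have sum_eq: "(\<Sum>S\<in>?F. of_bool (R \<subseteq> S)) = real (card {S. S \<subseteq> {..<D} \<and> card S = N \<and> R \<subseteq> S})"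
      using finF by (simp add: of_bool_def sum.If_cases Int_def conj_assoc)
    show "(\<Sum>S\<in>?F. of_bool (R \<subseteq> S)) \<le> (real N / real D) ^ card R * real (D choose N)"
    proof (cases "card R \<le> N")
      case True
      thus ?thesis
        unfolding sum_eq using R assms by (subst card_supersets) (auto intro: binomial_ratio_le)
    next
      case False
      \<comment> \<open>A set with more than \<open>N\<close> points lies in no admissible support,
        so its contribution vanishes.\<close>
      have "card R \<le> card S" if "S \<subseteq> {..<D}" "R \<subseteq> S" for S
        using that by (meson card_mono finite_lessThan finite_subset)
      hence "{S. S \<subseteq> {..<D} \<and> card S = N \<and> R \<subseteq> S} = {}" using False by auto
      thus ?thesis unfolding sum_eq by (simp only:) simp
    qed
  qed (use assms in auto)
  also have "\<dots> = real (D choose N) * (\<Sum>R\<in>Pow A. (\<Prod>i\<in>R. a * (real N / real D)) * (\<Prod>i\<in>A - R. 1))"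
    by (simp add: sum_distrib_left power_mult_distrib algebra_simps power_divide)
  also have "\<dots> = real (D choose N) * (\<Prod>i\<in>A. a * (real N / real D) + 1)"
    by (subst prod_add[OF fA]) simp
  finally show ?thesis by (simp add: add.commute)
qed


section \<open>Overlap of a sparse random point with a fixed distribution\<close>

lemma nn_integral_sparse_unif:
  assumes "N \<le> D" and f: "f \<in> borel_measurable (\<Pi>\<^sub>M i\<in>{..<D}. borel)"
  shows "(\<integral>\<^sup>+x. f x \<partial>sparse_unif N D)
    = (\<Sum>S | S \<subseteq> {..<D} \<and> card S = N. (\<integral>\<^sup>+x. f x \<partial>face_unif S D) * ennreal (1 / real (D choose N)))"
proof -
  let ?F = "{S. S \<subseteq> {..<D} \<and> card S = N}"
  have "(\<integral>\<^sup>+x. f x \<partial>sparse_unif N D)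
      = (\<integral>\<^sup>+S. \<integral>\<^sup>+x. f x \<partial>face_unif S D \<partial>uniform_count_measure ?F)"
    unfolding sparse_unif_def by (rule nn_integral_bind[OF f face_unif_kernel])
  also have "\<dots> = (\<Sum>S\<in>?F. (\<integral>\<^sup>+x. f x \<partial>face_unif S D) * ennreal (1 / real (D choose N)))"
    unfolding uniform_count_measure_def using n_subsets[of "{..<D}" N]
    by (subst nn_integral_point_measure_finite) (auto intro!: sum.cong simp: mult.commute)
  finally show ?thesis .
qed

text \<open>Only the \<open>N\<close> coordinates in \<open>S\<close> contribute. Each light one is
  bounded through \<open>y\<close> by \<open>s / N\<close>, for a total of at most \<open>s\<close>;
  each heavy one is bounded through \<open>x\<close>, whose exponential moments are under
  control.\<close>

lemma AE_face_unif_sum_min_le: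
  assumes S: "S \<subseteq> {..<D}" "card S = N" "0 < N" and "0 \<le> s"
    and y: "\<And>i. i < D \<Longrightarrow> 0 \<le> y i" and A: "A = {i\<in>{..<D}. s / real N < y i}"
  shows "AE x in face_unif S D. (\<Sum>i<D. min (x i) (y i)) \<le> s + (\<Sum>i\<in>S \<inter> A. x i)"
proof -
  have fin: "finite S" using S finite_subset by blast
  have "S \<noteq> {}" using S by auto
  from AE_face_unif[OF fin S(1) this] show ?thesis
  proof eventually_elim
    case (elim x)
    have "(\<Sum>i<D. min (x i) (y i)) = (\<Sum>i\<in>S. min (x i) (y i))"
      using S elim y by (intro sum.mono_neutral_right) auto
    also have "\<dots> \<le> (\<Sum>i\<in>S. s / real N + (if i \<in> A then x i else 0))"
    proof (intro sum_mono)
      fix i assume "i \<in> S"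
      thus "min (x i) (y i) \<le> s / real N + (if i \<in> A then x i else 0)"
        using elim S A \<open>0 \<le> s\<close> by (auto simp: min_def add_increasing)
    qed
    also have "\<dots> = s + (\<Sum>i\<in>S \<inter> A. x i)"
      using fin S by (simp add: sum.distrib sum.inter_restrict)
    finally show ?case .
  qed
qed

text \<open>The choice \<open>s = sqrt p\<close> balances two costs. Light coordinates give the
  exponent \<open>N * s / 4\<close>. There are at most \<open>N / s\<close> heavy ones, which cost
  at most \<open>7 * p\<close> each on average, hence \<open>7 * N * s\<close> in total. The sum
  stays below \<open>8 * N * s\<close>.\<close>

lemma sparse_unif_mgf_le:
  assumes N: "2 \<le> N" "N \<le> D" and y: "\<And>i. i < D \<Longrightarrow> 0 \<le> y i" "(\<Sum>i<D. y i) \<le> 1"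
  shows "(\<integral>\<^sup>+x. ennreal (exp (real N / 4 * (\<Sum>i<D. min (x i) (y i)))) \<partial>sparse_unif N D)
    \<le> ennreal (exp (8 * real N * sqrt (real N / real D)))"
proof -
  let ?F = "{S. S \<subseteq> {..<D} \<and> card S = N}"
  let ?f = "\<lambda>x. ennreal (exp (real N / 4 * (\<Sum>i<D. min (x i) (y i))))"
  define p where "p = real N / real D"
  define s where "s = sqrt p"
  have "p > 0" using N by (auto simp: p_def)
  hence "s > 0" and pps: "p / s = s" by (auto simp: s_def real_div_sqrt)
  define A where "A = {i\<in>{..<D}. s / real N < y i}"
  have cardA: "real (card A) * s \<le> real N"
  proof -
    have "real (card A) * (s / real N) = (\<Sum>i\<in>A. s / real N)" by simp
    also have "\<dots> \<le> (\<Sum>i\<in>A. y i)" by (intro sum_mono) (auto simp: A_def)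
    also have "\<dots> \<le> (\<Sum>i<D. y i)" using y by (intro sum_mono2) (auto simp: A_def)
    finally have "real (card A) * (s / real N) \<le> 1" using y by linarith
    thus ?thesis using N by (simp add: field_simps)
  qed
  have f: "?f \<in> borel_measurable (\<Pi>\<^sub>M i\<in>{..<D}. borel)"
    by measurable
  have face: "(\<integral>\<^sup>+x. ?f x \<partial>face_unif S D) \<le> ennreal (exp (real N * s / 4) * 8 ^ card (S \<inter> A))"
    if S: "S \<in> ?F" for S
  proof -
    have fin: "finite S" using S finite_subset by auto
    have sets: "sets (face_unif S D) = sets (\<Pi>\<^sub>M i\<in>{..<D}. borel)" by (simp add: face_unif_def)
    have "(\<integral>\<^sup>+x. ?f x \<partial>face_unif S D)
        \<le> (\<integral>\<^sup>+x. ennreal (exp (real N * s / 4)) * ennreal (exp (real (card S) / 4 * (\<Sum>i\<in>S \<inter> A. x i))) \<partial>face_unif S D)"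
    proof (rule nn_integral_mono_AE)
      have "AE x in face_unif S D. (\<Sum>i<D. min (x i) (y i)) \<le> s + (\<Sum>i\<in>S \<inter> A. x i)"
        using S N \<open>s > 0\<close> y by (intro AE_face_unif_sum_min_le[where N = N]) (auto simp: A_def)
      thus "AE x in face_unif S D. ?f x
          \<le> ennreal (exp (real N * s / 4)) * ennreal (exp (real (card S) / 4 * (\<Sum>i\<in>S \<inter> A. x i)))"
      proof eventually_elim
        case (elim x)
        have "real N / 4 * (\<Sum>i<D. min (x i) (y i)) \<le> real N / 4 * (s + (\<Sum>i\<in>S \<inter> A. x i))"
          using elim by (intro mult_left_mono) auto
        thus ?case
          using S by (simp add: ennreal_mult[symmetric] exp_add[symmetric] algebra_simps)
      qed
    qed
    also have "\<dots> = ennreal (exp (real N * s / 4))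
        * (\<integral>\<^sup>+x. ennreal (exp (real (card S) / 4 * (\<Sum>i\<in>S \<inter> A. x i))) \<partial>face_unif S D)"
    proof (rule nn_integral_cmult)
      have [measurable]: "(\<lambda>x. x i) \<in> borel_measurable (\<Pi>\<^sub>M i\<in>{..<D}. (borel :: real measure))" if "i \<in> S \<inter> A" for i
        using that by (intro measurable_component_singleton) (auto simp: A_def)
      have "(\<lambda>x. ennreal (exp (real (card S) / 4 * (\<Sum>i\<in>S \<inter> A. x i)))) \<in> borel_measurable (\<Pi>\<^sub>M i\<in>{..<D}. borel)"
        by measurable
      thus "(\<lambda>x. ennreal (exp (real (card S) / 4 * (\<Sum>i\<in>S \<inter> A. x i)))) \<in> borel_measurable (face_unif S D)"
        using measurable_cong_sets[OF sets refl] by blast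
    qed
    also have "\<dots> \<le> ennreal (exp (real N * s / 4)) * ennreal (8 ^ card (S \<inter> A))"
      using S N fin by (intro mult_left_mono face_unif_mgf_le) auto
    finally show ?thesis by (simp add: ennreal_mult)
  qed
  have C: "real (D choose N) > 0" using N by simp
  have "(\<integral>\<^sup>+x. ?f x \<partial>sparse_unif N D)
      \<le> (\<Sum>S\<in>?F. ennreal (exp (real N * s / 4) * 8 ^ card (S \<inter> A)) * ennreal (1 / real (D choose N)))"
    unfolding nn_integral_sparse_unif[OF N(2) f] by (intro sum_mono mult_right_mono face) auto
  also have "\<dots> = ennreal (exp (real N * s / 4) / real (D choose N) * (\<Sum>S\<in>?F. 8 ^ card (S \<inter> A)))"
    by (simp add: ennreal_mult[symmetric] sum_distrib_left)
  also have "\<dots> \<le> ennreal (exp (8 * real N * s))"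
  proof (rule ennreal_leI)
    \<comment> \<open>The factor 8 per heavy coordinate in the support is \<open>1 + a\<close> with
      \<open>a = 7\<close>.\<close>
    have "(\<Sum>S\<in>?F. 8 ^ card (S \<inter> A)) \<le> real (D choose N) * (1 + 7 * p) ^ card A"
      using sum_power_card_inter_le[of A D N 7] N by (auto simp: A_def p_def)
    also have "\<dots> \<le> real (D choose N) * exp (7 * p) ^ card A"
      using \<open>p > 0\<close> exp_ge_add_one_self[of "7 * p"] by (intro mult_left_mono power_mono) auto
    \<comment> \<open>Writing \<open>p\<close> as \<open>s * (p / s)\<close> brings in
      \<open>card A * s\<close>, which is at most \<open>N\<close>; the remaining
      \<open>p / s\<close> equals \<open>s\<close>.\<close>
    also have "exp (7 * p) ^ card A = exp (real (card A) * s * 7 * (p / s))"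
      using \<open>s > 0\<close> by (simp add: exp_of_nat_mult[symmetric] mult_ac)
    also have "\<dots> \<le> exp (real N * 7 * s)"
      unfolding pps using mult_right_mono[OF cardA, of "7 * s"] \<open>s > 0\<close> by (simp add: mult_ac)
    finally have "(\<Sum>S\<in>?F. 8 ^ card (S \<inter> A)) \<le> real (D choose N) * exp (real N * 7 * s)"
      by (simp add: mult_left_mono)
    hence "exp (real N * s / 4) / real (D choose N) * (\<Sum>S\<in>?F. 8 ^ card (S \<inter> A))
        \<le> exp (real N * s / 4) / real (D choose N) * (real (D choose N) * exp (real N * 7 * s))"
      by (rule mult_left_mono) auto
    also have "\<dots> = exp (real N * s / 4 + real N * 7 * s)"
      using C by (simp only: exp_add) simp
    also have "\<dots> \<le> exp (8 * real N * s)"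
      using \<open>s > 0\<close> by (simp add: mult_ac)
    finally show "exp (real N * s / 4) / real (D choose N) * (\<Sum>S\<in>?F. 8 ^ card (S \<inter> A)) \<le> exp (8 * real N * s)" .
  qed
  finally show ?thesis by (simp add: s_def p_def)
qed

section \<open>Chernoff bound for tuples\<close>

lemma prod_le_prod_ennreal:
  fixes f g :: "'a \<Rightarrow> ennreal"
  assumes "\<And>i. i \<in> A \<Longrightarrow> f i \<le> g i"
  shows "prod f A \<le> prod g A"
  using assms by (induction A rule: infinite_finite_induct) (auto intro!: mult_mono)

text \<open>Markov's inequality for the exponential of the total overlap with parameter
  \<open>N / 4\<close>. The tuple law is a product measure, so the moment is the product of the
  one-point moments.\<close>

lemma measure_tuple_unif_overlap_le:
  fixes a :: real
  assumes N: "2 \<le> N" "N \<le> D"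
    and y: "\<And>j i. j < k \<Longrightarrow> i < D \<Longrightarrow> 0 \<le> y j i" "\<And>j. j < k \<Longrightarrow> (\<Sum>i<D. y j i) \<le> 1"
  defines "B \<equiv> {x \<in> space (tuple_unif k N D). a \<le> (\<Sum>j<k. \<Sum>i<D. min (x j i) (y j i))}"
  shows "B \<in> sets (tuple_unif k N D)"
    and "measure (tuple_unif k N D) B
      \<le> exp (real k * (8 * real N * sqrt (real N / real D)) - real N / 4 * a)"
proof -
  let ?W = "\<lambda>j x. \<Sum>i<D. min (x i) (y j i)"
  let ?E = "8 * real N * sqrt (real N / real D)"
  interpret sp: prob_space "sparse_unif N D" by (rule prob_space_sparse_unif[OF N(2)])
  interpret product_sigma_finite "\<lambda>_::nat. sparse_unif N D" by standard
  interpret T: prob_space "tuple_unif k N D" by (rule prob_space_tuple_unif[OF N(2)])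
  have Wb: "?W j \<in> borel_measurable (\<Pi>\<^sub>M i\<in>{..<D}. borel)" for j
    by measurable
  have W [measurable]: "?W j \<in> borel_measurable (sparse_unif N D)" for j
    using Wb measurable_cong_sets[OF sets_sparse_unif[OF N(2)] refl] by blast
  have WT: "(\<lambda>x. ?W j (x j)) \<in> borel_measurable (tuple_unif k N D)" if "j < k" for j
    unfolding tuple_unif_def using that
    by (intro measurable_compose[OF measurable_component_singleton[of j] W[of j]]) auto
  have SW: "(\<lambda>x. \<Sum>j<k. ?W j (x j)) \<in> borel_measurable (tuple_unif k N D)"
    by (intro borel_measurable_sum WT) auto
  thus B: "B \<in> sets (tuple_unif k N D)"
    unfolding B_def by measurable
  have "emeasure (tuple_unif k N D) B = (\<integral>\<^sup>+x. indicator B x \<partial>tuple_unif k N D)"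
    using B by simp
  also have "\<dots> \<le> (\<integral>\<^sup>+x. ennreal (exp (- (real N / 4 * a))) * (\<Prod>j<k. ennreal (exp (real N / 4 * ?W j (x j)))) \<partial>tuple_unif k N D)"
  proof (rule nn_integral_mono)
    fix x
    \<comment> \<open>Markov's inequality in pointwise form: the exponent is nonnegative on
      \<open>B\<close>.\<close>
    have "indicator B x \<le> ennreal (exp (real N / 4 * ((\<Sum>j<k. ?W j (x j)) - a)))"
    proof (cases "x \<in> B")
      case True
      hence "0 \<le> real N / 4 * ((\<Sum>j<k. ?W j (x j)) - a)" by (auto simp: B_def)
      hence "1 \<le> exp (real N / 4 * ((\<Sum>j<k. ?W j (x j)) - a))" by simp
      thus ?thesis using True by simp
    qed simp
    also have "exp (real N / 4 * ((\<Sum>j<k. ?W j (x j)) - a))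
        = exp (- (real N / 4 * a)) * (\<Prod>j<k. exp (real N / 4 * ?W j (x j)))"
      unfolding exp_sum[OF finite_lessThan, symmetric] exp_add[symmetric] sum_distrib_left[symmetric]
      by (simp add: algebra_simps)
    also have "ennreal \<dots> = ennreal (exp (- (real N / 4 * a))) * (\<Prod>j<k. ennreal (exp (real N / 4 * ?W j (x j))))"
      by (subst ennreal_mult) (auto intro!: prod_nonneg simp: prod_ennreal)
    finally show "indicator B x \<le> ennreal (exp (- (real N / 4 * a))) * (\<Prod>j<k. ennreal (exp (real N / 4 * ?W j (x j))))" .
  qed
  also have "\<dots> = ennreal (exp (- (real N / 4 * a)))
      * (\<integral>\<^sup>+x. (\<Prod>j<k. ennreal (exp (real N / 4 * ?W j (x j)))) \<partial>tuple_unif k N D)"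
  proof (rule nn_integral_cmult)
    show "(\<lambda>x. \<Prod>j<k. ennreal (exp (real N / 4 * ?W j (x j)))) \<in> borel_measurable (tuple_unif k N D)"
    proof (rule borel_measurable_prod_ennreal)
      fix j assume "j \<in> {..<k}"
      hence "j < k" by simp
      from WT[OF this] show "(\<lambda>x. ennreal (exp (real N / 4 * ?W j (x j)))) \<in> borel_measurable (tuple_unif k N D)"
        by measurable
    qed
  qed
  also have "(\<integral>\<^sup>+x. (\<Prod>j<k. ennreal (exp (real N / 4 * ?W j (x j)))) \<partial>tuple_unif k N D)
      = (\<Prod>j<k. \<integral>\<^sup>+x. ennreal (exp (real N / 4 * ?W j x)) \<partial>sparse_unif N D)"
    unfolding tuple_unif_def
    by (rule product_nn_integral_prod[where f = "\<lambda>j x. ennreal (exp (real N / 4 * ?W j x))"]) auto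
  also have "\<dots> \<le> (\<Prod>j<k. ennreal (exp ?E))"
    using y by (intro prod_le_prod_ennreal sparse_unif_mgf_le N) auto
  also have "(\<Prod>j<k. ennreal (exp ?E)) = ennreal (exp (real k * ?E))"
    by (simp add: ennreal_power exp_of_nat_mult)
  also have "ennreal (exp (- (real N / 4 * a))) * ennreal (exp (real k * ?E))
      = ennreal (exp (real k * ?E - real N / 4 * a))"
    by (simp add: ennreal_mult[symmetric] exp_add[symmetric])
  finally have "emeasure (tuple_unif k N D) B \<le> ennreal (exp (real k * ?E - real N / 4 * a))"
    by (simp add: mult_left_mono)
  thus "measure (tuple_unif k N D) B \<le> exp (real k * ?E - real N / 4 * a)"
    by (simp add: T.emeasure_eq_measure)
qed

section \<open>A net in the set of circuits\<close>

text \<open>Reading \<open>sub_index\<close> as a Horner sum of digits allows equality of indices to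
  be checked bit by bit.\<close>

lemma bit_sub_index: "bit (sub_index g q j) i \<longleftrightarrow> i < g \<and> bit j (q i)"
proof -
  have "sub_index g q j = horner_sum of_bool 2 (map (\<lambda>i. bit j (q i)) [0..<g])"
    by (simp add: sub_index_def horner_sum_eq_sum lessThan_atLeast0)
  thus ?thesis by (auto simp: bit_horner_sum_bit_iff)
qed

lemma less_power_two_iff_bit: "(r :: nat) < 2 ^ n \<longleftrightarrow> (\<forall>i. bit r i \<longrightarrow> i < n)"
proof
  assume "r < 2 ^ n"
  hence "take_bit n r = r" by (simp add: take_bit_nat_eq_self)
  thus "\<forall>i. bit r i \<longrightarrow> i < n" by (metis bit_take_bit_iff)
next
  assume *: "\<forall>i. bit r i \<longrightarrow> i < n"
  have "take_bit n r = r"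
    by (rule bit_eqI) (use * in \<open>auto simp: bit_take_bit_iff\<close>)
  thus "r < 2 ^ n" by (metis take_bit_nat_less_exp)
qed

text \<open>\<open>gate_on\<close> is block diagonal with respect to this equivalence relation on indices.\<close>

definition same_rest :: "nat \<Rightarrow> nat \<Rightarrow> (nat \<Rightarrow> nat) \<Rightarrow> nat \<Rightarrow> nat \<Rightarrow> bool" where
  "same_rest g n q r c \<longleftrightarrow> (\<forall>i<n. i \<notin> q ` {..<g} \<longrightarrow> bit r i = bit c i)"

text \<open>Inside a class the digits at the other qubits are fixed while those at the chosen qubits
  are free, so the class is a copy of the basis of \<open>g\<close> qubits.\<close>

lemma bij_betw_sub_index:
  assumes q: "q ` {..<g} \<subseteq> {..<n}" "inj_on q {..<g}"
  shows "bij_betw (sub_index g q) {r. r < 2 ^ n \<and> same_rest g n q r c} {..<2 ^ g}"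
  unfolding bij_betw_def
proof
  let ?R = "{r. r < 2 ^ n \<and> same_rest g n q r c}"
  show "inj_on (sub_index g q) ?R"
  proof (rule inj_onI)
    fix r s assume r: "r \<in> ?R" and s: "s \<in> ?R" and eq: "sub_index g q r = sub_index g q s"
    show "r = s"
    proof (rule bit_eqI)
      fix i
      consider "i \<ge> n" | j where "j < g" "i = q j" | "i < n" "i \<notin> q ` {..<g}"
        by (meson imageE lessThan_iff linorder_not_less)
      thus "bit r i = bit s i"
      proof cases
        case 1
        thus ?thesis using r s by (auto simp: less_power_two_iff_bit)
      next
        case 2
        thus ?thesis using arg_cong[OF eq, of "\<lambda>x. bit x j"] by (simp add: bit_sub_index)
      next
        case 3
        thus ?thesis using r s by (auto simp: same_rest_def)
      qed
    qed
  qed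
  show "sub_index g q ` ?R = {..<2 ^ g}"
  proof
    show "sub_index g q ` ?R \<subseteq> {..<2 ^ g}"
      by (auto simp: less_power_two_iff_bit bit_sub_index)
    show "{..<2 ^ g} \<subseteq> sub_index g q ` ?R"
    proof
      fix x :: nat assume "x \<in> {..<2 ^ g}"
      \<comment> \<open>The preimage takes the digits of \<open>x\<close> at the chosen qubits and
        those of \<open>c\<close> elsewhere.\<close>
      define r :: nat where "r = horner_sum of_bool 2
        (map (\<lambda>i. if i \<in> q ` {..<g} then bit x (inv_into {..<g} q i) else bit c i) [0..<n])"
      have bit_r: "bit r i \<longleftrightarrow> i < n \<and> (if i \<in> q ` {..<g} then bit x (inv_into {..<g} q i) else bit c i)" for i
        by (auto simp: r_def bit_horner_sum_bit_iff)
      have "r \<in> ?R"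
        by (auto simp: less_power_two_iff_bit bit_r same_rest_def)
      moreover have "sub_index g q r = x"
      proof (rule bit_eqI)
        fix i
        show "bit (sub_index g q r) i = bit x i"
        proof (cases "i < g")
          case True
          thus ?thesis using q by (auto simp: bit_sub_index bit_r inv_into_f_f)
        next
          case False
          thus ?thesis using \<open>x \<in> {..<2 ^ g}\<close> by (auto simp: bit_sub_index less_power_two_iff_bit)
        qed
      qed
      ultimately show "x \<in> sub_index g q ` ?R" by blast
    qed
  qed
qed

lemma sub_index_less: "sub_index g q r < 2 ^ g"
  by (auto simp: less_power_two_iff_bit bit_sub_index)

lemma card_same_rest:
  assumes "q ` {..<g} \<subseteq> {..<n}" "inj_on q {..<g}"
  shows "card {r. r < 2 ^ n \<and> same_rest g n q r c} = 2 ^ g"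
  using bij_betw_same_card[OF bij_betw_sub_index[OF assms]] by simp

lemma same_rest_commute: "same_rest g n q r c \<longleftrightarrow> same_rest g n q c r"
  by (auto simp: same_rest_def)

lemma same_rest_trans: "same_rest g n q r c \<Longrightarrow> same_rest g n q c d \<Longrightarrow> same_rest g n q r d"
  by (auto simp: same_rest_def)

lemma gate_on_carrier [simp]: "gate_on g n q V \<in> carrier_mat (2 ^ n) (2 ^ n)"
  by (simp add: gate_on_def)

lemma gate_on_index:
  assumes "r < 2 ^ n" "c < 2 ^ n"
  shows "gate_on g n q V $$ (r, c)
    = (if same_rest g n q r c then V $$ (sub_index g q r, sub_index g q c) else 0)"
  using assms by (simp add: gate_on_def same_rest_def)

lemma mat_adjoint_carrier [simp]:
  "G \<in> carrier_mat a b \<Longrightarrow> mat_adjoint G \<in> carrier_mat b a"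
  unfolding mat_adjoint_def by (intro mat_of_rows_carrier carrier_matI) auto

lemma mat_adjoint_mult_index:
  fixes G :: "complex mat"
  assumes "G \<in> carrier_mat a d" "c < d" "c' < d"
  shows "(mat_adjoint G * G) $$ (c, c') = (\<Sum>r<a. cnj (G $$ (r, c)) * G $$ (r, c'))"
  using assms by (simp add: mat_adjoint_def scalar_prod_def atLeast0LessThan)

text \<open>The matrix consists of one copy of \<open>V\<close> for each class, so orthonormality of
  its columns reduces to that of the columns of \<open>V\<close>.\<close>

lemma gate_on_adjoint_mult:
  assumes q: "q ` {..<g} \<subseteq> {..<n}" "inj_on q {..<g}" and V: "V \<in> unitary_mats (2 ^ g)"
  shows "mat_adjoint (gate_on g n q V) * gate_on g n q V = 1\<^sub>m (2 ^ n)"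
proof (rule eq_matI)
  let ?G = "gate_on g n q V" and ?s = "sub_index g q"
  fix c d assume cd: "c < dim_row (1\<^sub>m (2 ^ n) :: complex mat)" "d < dim_col (1\<^sub>m (2 ^ n) :: complex mat)"
  hence c: "c < 2 ^ n" and d: "d < 2 ^ n" by auto
  have V': "V \<in> carrier_mat (2 ^ g) (2 ^ g)" "mat_adjoint V * V = 1\<^sub>m (2 ^ g)"
    using V by (auto simp: unitary_mats_def)
  have "(mat_adjoint ?G * ?G) $$ (c, d) = (\<Sum>r<2 ^ n. cnj (?G $$ (r, c)) * ?G $$ (r, d))"
    using c d by (intro mat_adjoint_mult_index[of _ _ "2 ^ n"]) auto
  also have "\<dots> = (\<Sum>r<2 ^ n. if same_rest g n q r c \<and> same_rest g n q r d
      then cnj (V $$ (?s r, ?s c)) * V $$ (?s r, ?s d) else 0)"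
    using c d by (intro sum.cong) (auto simp: gate_on_index)
  also have "\<dots> = (if c = d then 1 else 0)"
  proof (cases "same_rest g n q c d")
    case True
    hence "same_rest g n q r c \<and> same_rest g n q r d \<longleftrightarrow> same_rest g n q r c" for r
      using same_rest_trans by blast
    hence "(\<Sum>r<2 ^ n. if same_rest g n q r c \<and> same_rest g n q r d
        then cnj (V $$ (?s r, ?s c)) * V $$ (?s r, ?s d) else 0)
      = (\<Sum>r | r < 2 ^ n \<and> same_rest g n q r c. cnj (V $$ (?s r, ?s c)) * V $$ (?s r, ?s d))"
      by (simp add: sum.If_cases) (rule sum.cong, auto)
    also have "\<dots> = (\<Sum>x<2 ^ g. cnj (V $$ (x, ?s c)) * V $$ (x, ?s d))"
      by (rule sum.reindex_bij_betw[OF bij_betw_sub_index[OF q]])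
    also have "\<dots> = (mat_adjoint V * V) $$ (?s c, ?s d)"
      using V' sub_index_less by (intro mat_adjoint_mult_index[symmetric]) auto
    also have "\<dots> = (if ?s c = ?s d then 1 else 0)"
      using sub_index_less by (simp add: V')
    also have "?s c = ?s d \<longleftrightarrow> c = d"
      using bij_betw_imp_inj_on[OF bij_betw_sub_index[OF q, of d]] c d True
      by (auto simp: inj_on_def same_rest_def)
    finally show ?thesis .
  next
    case False
    \<comment> \<open>Columns from different classes have disjoint supports.\<close>
    hence "\<not> (same_rest g n q r c \<and> same_rest g n q r d)" for r
      using same_rest_trans same_rest_commute by blast
    moreover have "c \<noteq> d" using False by (auto simp: same_rest_def)
    ultimately show ?thesis by (subst sum.neutral) auto
  qed
  finally show "(mat_adjoint ?G * ?G) $$ (c, d) = 1\<^sub>m (2 ^ n) $$ (c, d)"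
    using c d by simp
qed (auto simp: mat_adjoint_def gate_on_def)

section \<open>Euclidean norms and propagation of errors\<close>

definition vec_norm2 :: "complex Matrix.vec \<Rightarrow> real" where
  "vec_norm2 v = L2_set (\<lambda>i. cmod (v $ i)) {..<dim_vec v}"

lemma vec_norm2_nonneg [simp]: "0 \<le> vec_norm2 v"
  by (simp add: vec_norm2_def)

lemma vec_norm2_triangle:
  assumes "v \<in> carrier_vec d" "w \<in> carrier_vec d"
  shows "vec_norm2 (v + w) \<le> vec_norm2 v + vec_norm2 w"
proof -
  have "vec_norm2 (v + w) \<le> L2_set (\<lambda>i. cmod (v $ i) + cmod (w $ i)) {..<d}"
    unfolding vec_norm2_def using assms
    by (auto intro!: L2_set_mono norm_triangle_ineq)
  also have "\<dots> \<le> vec_norm2 v + vec_norm2 w"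
    using L2_set_triangle_ineq assms by (simp add: vec_norm2_def)
  finally show ?thesis .
qed

lemma vec_norm2_isometry:
  assumes G: "G \<in> carrier_mat d d" "mat_adjoint G * G = 1\<^sub>m d" and v: "v \<in> carrier_vec d"
  shows "vec_norm2 (G *\<^sub>v v) = vec_norm2 v"
proof -
  have Gv: "(G *\<^sub>v v) $ r = (\<Sum>c<d. G $$ (r, c) * v $ c)" if "r < d" for r
    using G v that by (simp add: scalar_prod_def atLeast0LessThan)
  \<comment> \<open>The squared norm is expanded over the complex numbers as a sum of products with
    conjugates; moving the row sum innermost then exposes the entries of
    \<open>mat_adjoint G * G\<close>.\<close>
  have "complex_of_real (\<Sum>r<d. (cmod ((G *\<^sub>v v) $ r))\<^sup>2)
      = (\<Sum>r<d. (\<Sum>c<d. cnj (G $$ (r, c) * v $ c)) * (\<Sum>c'<d. G $$ (r, c') * v $ c'))"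
    by (simp only: of_real_sum complex_norm_square) (simp add: Gv mult.commute)
  also have "\<dots> = (\<Sum>r<d. \<Sum>c<d. \<Sum>c'<d. cnj (v $ c) * v $ c' * (cnj (G $$ (r, c)) * G $$ (r, c')))"
    unfolding sum_product complex_cnj_mult by (simp only: mult_ac)
  also have "\<dots> = (\<Sum>c<d. \<Sum>r<d. \<Sum>c'<d. cnj (v $ c) * v $ c' * (cnj (G $$ (r, c)) * G $$ (r, c')))"
    by (rule sum.swap)
  also have "\<dots> = (\<Sum>c<d. \<Sum>c'<d. \<Sum>r<d. cnj (v $ c) * v $ c' * (cnj (G $$ (r, c)) * G $$ (r, c')))"
    by (intro sum.cong refl sum.swap)
  also have "\<dots> = (\<Sum>c<d. \<Sum>c'<d. cnj (v $ c) * v $ c' * (mat_adjoint G * G) $$ (c, c'))"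
    using G(1) by (intro sum.cong refl) (simp add: mat_adjoint_mult_index sum_distrib_left del: index_mult_mat)
  also have "\<dots> = (\<Sum>c<d. \<Sum>c'<d. if c' = c then cnj (v $ c) * v $ c' else 0)"
    unfolding G(2) by (intro sum.cong refl) auto
  also have "\<dots> = (\<Sum>c<d. cnj (v $ c) * v $ c)"
    by (simp add: sum.delta)
  also have "\<dots> = complex_of_real (\<Sum>c<d. (cmod (v $ c))\<^sup>2)"
    by (simp only: of_real_sum complex_norm_square) (simp add: mult.commute)
  finally show ?thesis
    using G v by (simp add: vec_norm2_def L2_set_def of_real_eq_iff del: of_real_sum)
qed

text \<open>Each row involves only the \<open>2 ^ g\<close> columns of its class, so Cauchy-Schwarz
  gives one factor \<open>2 ^ g\<close> in the squared norm. Each column meets only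
  \<open>2 ^ g\<close> rows, which gives the second. The resulting factor is free of
  \<open>n\<close>.\<close>

lemma vec_norm2_gate_on_diff_le:
  assumes q: "q ` {..<g} \<subseteq> {..<n}" "inj_on q {..<g}" and v: "v \<in> carrier_vec (2 ^ n)"
    and V: "\<And>x y. x < 2 ^ g \<Longrightarrow> y < 2 ^ g \<Longrightarrow> cmod (V $$ (x, y) - V' $$ (x, y)) \<le> \<eta>"
  shows "vec_norm2 (gate_on g n q V *\<^sub>v v - gate_on g n q V' *\<^sub>v v) \<le> 2 ^ g * \<eta> * vec_norm2 v"
proof -
  let ?G = "gate_on g n q V" and ?G' = "gate_on g n q V'" and ?R = "same_rest g n q" and ?s = "sub_index g q"
  \<comment> \<open>The entry at \<open>(0, 0)\<close> always exists, and the modulus of its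
    difference bounds \<open>\<eta>\<close> from below.\<close>
  have "0 \<le> \<eta>" by (rule order_trans[OF norm_ge_zero V[of 0 0]]) auto
  have ent: "(cmod ((?G *\<^sub>v v - ?G' *\<^sub>v v) $ r))\<^sup>2 \<le> \<eta>\<^sup>2 * 2 ^ g * (\<Sum>c<2 ^ n. of_bool (?R r c) * (cmod (v $ c))\<^sup>2)"
    if r: "r < 2 ^ n" for r
  proof -
    have restr: "(\<Sum>c<2 ^ n. if ?R r c then h c else 0) = (\<Sum>c\<in>{c. c < 2 ^ n \<and> ?R c r}. h c)"
      for h :: "nat \<Rightarrow> real"
      by (rule sum.mono_neutral_cong_right) (use same_rest_commute in auto)
    have "(?G *\<^sub>v v - ?G' *\<^sub>v v) $ r = (\<Sum>c<2 ^ n. (?G $$ (r, c) - ?G' $$ (r, c)) * v $ c)"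
      using r v carrier_matD[OF gate_on_carrier, of g n q]
      by (simp add: scalar_prod_def atLeast0LessThan sum_subtractf algebra_simps)
    also have "\<dots> = (\<Sum>c<2 ^ n. if ?R r c then (V $$ (?s r, ?s c) - V' $$ (?s r, ?s c)) * v $ c else 0)"
      using r by (intro sum.cong) (auto simp: gate_on_index)
    finally have eq: "(?G *\<^sub>v v - ?G' *\<^sub>v v) $ r = \<dots>" .
    have "cmod ((?G *\<^sub>v v - ?G' *\<^sub>v v) $ r) \<le> (\<Sum>c<2 ^ n. if ?R r c then \<eta> * cmod (v $ c) else 0)"
      unfolding eq by (rule sum_norm_le) (auto simp: norm_mult intro!: mult_right_mono V sub_index_less)
    also have "\<dots> = \<eta> * (\<Sum>c\<in>{c. c < 2 ^ n \<and> ?R c r}. cmod (v $ c))"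
      by (simp only: restr sum_distrib_left)
    finally have "(cmod ((?G *\<^sub>v v - ?G' *\<^sub>v v) $ r))\<^sup>2 \<le> (\<eta> * (\<Sum>c\<in>{c. c < 2 ^ n \<and> ?R c r}. cmod (v $ c)))\<^sup>2"
      by (intro power_mono) auto
    also have "\<dots> \<le> \<eta>\<^sup>2 * (2 ^ g * (\<Sum>c\<in>{c. c < 2 ^ n \<and> ?R c r}. (cmod (v $ c))\<^sup>2))"
    proof -
      \<comment> \<open>Cauchy-Schwarz against the constant one on a class.\<close>
      have "(\<Sum>c\<in>{c. c < 2 ^ n \<and> ?R c r}. 1 * cmod (v $ c))\<^sup>2
          \<le> (\<Sum>c\<in>{c. c < 2 ^ n \<and> ?R c r}. 1\<^sup>2) * (\<Sum>c\<in>{c. c < 2 ^ n \<and> ?R c r}. (cmod (v $ c))\<^sup>2)"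
        by (rule Cauchy_Schwarz_ineq_sum)
      thus ?thesis
        unfolding power_mult_distrib using card_same_rest[OF q, of r] by (intro mult_left_mono) auto
    qed
    also have "(\<Sum>c\<in>{c. c < 2 ^ n \<and> ?R c r}. (cmod (v $ c))\<^sup>2) = (\<Sum>c<2 ^ n. of_bool (?R r c) * (cmod (v $ c))\<^sup>2)"
      unfolding restr[symmetric] by (intro sum.cong) auto
    finally show ?thesis by (simp add: mult.assoc)
  qed
  have "(vec_norm2 (?G *\<^sub>v v - ?G' *\<^sub>v v))\<^sup>2 = (\<Sum>r<2 ^ n. (cmod ((?G *\<^sub>v v - ?G' *\<^sub>v v) $ r))\<^sup>2)"
    by (simp add: vec_norm2_def L2_set_def sum_nonneg gate_on_def)
  also have "\<dots> \<le> (\<Sum>r<2 ^ n. \<eta>\<^sup>2 * 2 ^ g * (\<Sum>c<2 ^ n. of_bool (?R r c) * (cmod (v $ c))\<^sup>2))"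
    by (intro sum_mono ent) auto
  also have "\<dots> = \<eta>\<^sup>2 * 2 ^ g * (\<Sum>r<2 ^ n. \<Sum>c<2 ^ n. of_bool (?R r c) * (cmod (v $ c))\<^sup>2)"
    by (simp add: sum_distrib_left)
  also have "(\<Sum>r<2 ^ n. \<Sum>c<2 ^ n. of_bool (?R r c) * (cmod (v $ c))\<^sup>2)
      = (\<Sum>c<2 ^ n. (\<Sum>r<2 ^ n. of_bool (?R r c)) * (cmod (v $ c))\<^sup>2)"
    by (subst sum.swap) (simp add: sum_distrib_right)
  also have "\<dots> = (\<Sum>c<2 ^ n. 2 ^ g * (cmod (v $ c))\<^sup>2)"
  proof (intro sum.cong refl)
    fix c
    have "(\<Sum>r<2 ^ n. of_bool (?R r c)) = real (card {r. r < 2 ^ n \<and> ?R r c})"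
      by (simp add: of_bool_def sum.If_cases Int_def)
    thus "(\<Sum>r<2 ^ n. of_bool (?R r c)) * (cmod (v $ c))\<^sup>2 = 2 ^ g * (cmod (v $ c))\<^sup>2"
      using card_same_rest[OF q] by simp
  qed
  also have "\<eta>\<^sup>2 * 2 ^ g * \<dots> = (2 ^ g * \<eta> * vec_norm2 v)\<^sup>2"
    using v by (simp add: vec_norm2_def L2_set_def sum_nonneg power_mult_distrib sum_distrib_left
        power2_eq_square mult_ac)
  finally have sq: "(vec_norm2 (?G *\<^sub>v v - ?G' *\<^sub>v v))\<^sup>2 \<le> (2 ^ g * \<eta> * vec_norm2 v)\<^sup>2" .
  show ?thesis
    by (rule power2_le_imp_le[OF sq]) (use \<open>0 \<le> \<eta>\<close> in simp)
qed

lemma gatesD: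
  assumes "G \<in> gates g n"
  shows "G \<in> carrier_mat (2 ^ n) (2 ^ n)" "mat_adjoint G * G = 1\<^sub>m (2 ^ n)"
  using assms by (auto simp: gates_def gate_on_adjoint_mult)

lemma foldr_gates_carrier:
  "set Vs \<subseteq> gates g n \<Longrightarrow> foldr (*) Vs (1\<^sub>m (2 ^ n)) \<in> carrier_mat (2 ^ n) (2 ^ n)"
  by (induction Vs) (auto intro: mult_carrier_mat dest: gatesD(1))

lemma foldr_gates_Cons_mult_vec:
  assumes "G \<in> gates g n" "set Vs \<subseteq> gates g n" "v \<in> carrier_vec (2 ^ n)"
  shows "foldr (*) (G # Vs) (1\<^sub>m (2 ^ n)) *\<^sub>v v = G *\<^sub>v (foldr (*) Vs (1\<^sub>m (2 ^ n)) *\<^sub>v v)"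
  using assms by (auto intro!: assoc_mult_mat_vec gatesD(1) foldr_gates_carrier)

lemma vec_norm2_foldr_gates:
  assumes "set Vs \<subseteq> gates g n" "v \<in> carrier_vec (2 ^ n)"
  shows "vec_norm2 (foldr (*) Vs (1\<^sub>m (2 ^ n)) *\<^sub>v v) = vec_norm2 v"
  using assms
proof (induction Vs)
  case (Cons G Vs)
  hence G: "G \<in> gates g n" and Vs: "set Vs \<subseteq> gates g n" by auto
  have "foldr (*) Vs (1\<^sub>m (2 ^ n)) *\<^sub>v v \<in> carrier_vec (2 ^ n)"
    using foldr_gates_carrier[OF Vs] Cons.prems by (intro mult_mat_vec_carrier)
  thus ?case
    unfolding foldr_gates_Cons_mult_vec[OF G Vs Cons.prems(2)]
    using vec_norm2_isometry[OF gatesD[OF G]] Cons.IH[OF Vs Cons.prems(2)] by simp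
qed simp

text \<open>Gates are exchanged one at a time. An error made so far is not amplified, since the next
  gate is an isometry, and each new error is relative to a vector whose norm is still that of
  \<open>v\<close>, since the replacing gates are isometries too.\<close>

lemma vec_norm2_foldr_gates_diff_le:
  assumes "list_all2 (\<lambda>G G'. \<forall>w\<in>carrier_vec (2 ^ n). vec_norm2 (G *\<^sub>v w - G' *\<^sub>v w) \<le> \<delta> * vec_norm2 w) Vs Vs'"
    and "set Vs \<subseteq> gates g n" "set Vs' \<subseteq> gates g n" and v: "v \<in> carrier_vec (2 ^ n)"
  shows "vec_norm2 (foldr (*) Vs (1\<^sub>m (2 ^ n)) *\<^sub>v v - foldr (*) Vs' (1\<^sub>m (2 ^ n)) *\<^sub>v v)
    \<le> real (length Vs) * \<delta> * vec_norm2 v"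
  using assms(1-3)
proof (induction Vs Vs' rule: list_all2_induct)
  case Nil
  have "v - v = 0\<^sub>v (2 ^ n)" using v by auto
  thus ?case by (simp add: vec_norm2_def L2_set_def)
next
  case (Cons G Vs G' Vs')
  hence G: "G \<in> gates g n" "G' \<in> gates g n" and Vs: "set Vs \<subseteq> gates g n" "set Vs' \<subseteq> gates g n"
    by auto
  define a where "a = foldr (*) Vs (1\<^sub>m (2 ^ n)) *\<^sub>v v"
  define a' where "a' = foldr (*) Vs' (1\<^sub>m (2 ^ n)) *\<^sub>v v"
  note Gc = gatesD(1)[OF G(1)] gatesD(1)[OF G(2)]
  have c: "a \<in> carrier_vec (2 ^ n)" "a' \<in> carrier_vec (2 ^ n)"
    unfolding a_def a'_def using v by (auto intro!: mult_mat_vec_carrier foldr_gates_carrier Vs)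
  \<comment> \<open>The first summand is the old error transported by \<open>G\<close>, the second
    the new error made at \<open>a'\<close>.\<close>
  have "G *\<^sub>v a - G' *\<^sub>v a' = G *\<^sub>v (a - a') + (G *\<^sub>v a' - G' *\<^sub>v a')"
    unfolding mult_minus_distrib_mat_vec[OF Gc(1) c] using Gc c
    by (intro eq_vecI) auto
  also have "vec_norm2 \<dots> \<le> vec_norm2 (G *\<^sub>v (a - a')) + vec_norm2 (G *\<^sub>v a' - G' *\<^sub>v a')"
    by (rule vec_norm2_triangle[of _ "2 ^ n"]) (use Gc c in auto)
  also have "vec_norm2 (G *\<^sub>v (a - a')) = vec_norm2 (a - a')"
    by (rule vec_norm2_isometry[OF gatesD[OF G(1)]]) (use c in auto)
  also have "\<dots> \<le> real (length Vs) * \<delta> * vec_norm2 v"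
    unfolding a_def a'_def using Cons.IH Vs by blast
  also have "vec_norm2 (G *\<^sub>v a' - G' *\<^sub>v a') \<le> \<delta> * vec_norm2 a'"
    using Cons.hyps c by blast
  also have "vec_norm2 a' = vec_norm2 v"
    unfolding a'_def by (rule vec_norm2_foldr_gates[OF Vs(2) v])
  finally show ?case
    unfolding foldr_gates_Cons_mult_vec[OF G(1) Vs(1) v] foldr_gates_Cons_mult_vec[OF G(2) Vs(2) v]
      a_def[symmetric] a'_def[symmetric] by (simp add: algebra_simps)
qed

section \<open>Rounding gates and counting the roundings\<close>

lemma cmod_unitary_le_1:
  assumes "V \<in> unitary_mats d" "r < d" "c < d"
  shows "cmod (V $$ (r, c)) \<le> 1"
proof -
  have V: "V \<in> carrier_mat d d" "mat_adjoint V * V = 1\<^sub>m d"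
    using assms by (auto simp: unitary_mats_def)
  have "complex_of_real (\<Sum>i<d. (cmod (V $$ (i, c)))\<^sup>2) = (mat_adjoint V * V) $$ (c, c)"
    unfolding mat_adjoint_mult_index[OF V(1) assms(3,3)] of_real_sum complex_norm_square
    by (simp add: mult.commute)
  also have "\<dots> = 1" using V assms by simp
  finally have "(\<Sum>i<d. (cmod (V $$ (i, c)))\<^sup>2) = 1"
    using of_real_eq_1_iff by blast
  moreover have "(cmod (V $$ (r, c)))\<^sup>2 \<le> (\<Sum>i<d. (cmod (V $$ (i, c)))\<^sup>2)"
    using assms by (intro member_le_sum) auto
  ultimately show ?thesis by (simp add: power_le_one_iff abs_square_le_1)
qed

text \<open>This is why a key may record \<open>q\<close> on \<open>{..<g}\<close> only, which
  leaves finitely many wirings.\<close>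

lemma gate_on_cong:
  assumes "\<And>i. i < g \<Longrightarrow> q i = q' i"
  shows "gate_on g n q V = gate_on g n q' V"
proof -
  have sub: "sub_index g q = sub_index g q'"
    unfolding sub_index_def fun_eq_iff using assms by (auto intro!: sum.cong)
  have img: "q ` {..<g} = q' ` {..<g}"
    using assms by (auto intro!: image_cong)
  show ?thesis unfolding gate_on_def sub img ..
qed

lemma abs_diff_le_if_floor_eq:
  assumes "\<lfloor>real M * x\<rfloor> = \<lfloor>real M * y\<rfloor>" "0 < M"
  shows "\<bar>x - y\<bar> \<le> 1 / real M"
proof -
  have "\<bar>real M * x - real M * y\<bar> \<le> 1"
    using floor_correct[of "real M * x"] floor_correct[of "real M * y"] assms(1) by linarith
  also have "\<bar>real M * x - real M * y\<bar> = real M * \<bar>x - y\<bar>"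
    by (simp add: abs_mult flip: right_diff_distrib)
  finally show ?thesis
    using assms(2) by (simp add: field_simps)
qed

text \<open>The second component names the cell of a square grid of width \<open>1 / M\<close> that
  contains each entry. Both components are extensional, so that keys lie in a finite function
  space.\<close>

definition gate_key :: "nat \<Rightarrow> nat \<Rightarrow> (nat \<Rightarrow> nat) \<Rightarrow> complex mat \<Rightarrow> (nat \<Rightarrow> nat) \<times> (nat \<times> nat \<Rightarrow> int \<times> int)" where
  "gate_key M g q V = (restrict q {..<g},
     \<lambda>p\<in>{..<2 ^ g} \<times> {..<2 ^ g}. (\<lfloor>real M * Re (V $$ p)\<rfloor>, \<lfloor>real M * Im (V $$ p)\<rfloor>))"

definition key_set :: "nat \<Rightarrow> nat \<Rightarrow> nat \<Rightarrow> ((nat \<Rightarrow> nat) \<times> (nat \<times> nat \<Rightarrow> int \<times> int)) set" where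
  "key_set M g n = ({..<g} \<rightarrow>\<^sub>E {..<n})
     \<times> ({..<2 ^ g} \<times> {..<2 ^ g} \<rightarrow>\<^sub>E {- int M..int M} \<times> {- int M..int M})"

lemma finite_key_set: "finite (key_set M g n)"
  unfolding key_set_def by (intro finite_cartesian_product finite_PiE) auto

text \<open>There are \<open>4 ^ g\<close> entries with two real parts each. A part in
  \<open>[-1, 1]\<close> has its floor in \<open>-M..M\<close>, where the upper end is attained at
  1; this accounts for \<open>2 * M + 1\<close>.\<close>

lemma card_key_set: "card (key_set M g n) = n ^ g * (2 * M + 1) ^ (2 * 4 ^ g)"
proof -
  have "card {- int M..int M} = 2 * M + 1" by simp
  hence "card (key_set M g n) = n ^ g * ((2 * M + 1) * (2 * M + 1)) ^ (2 ^ g * 2 ^ g)"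
    unfolding key_set_def card_cartesian_product by (subst card_PiE, simp)+ (simp add: card_cartesian_product)
  also have "((2 * M + 1) * (2 * M + 1)) ^ (2 ^ g * 2 ^ g) = (2 * M + 1) ^ (2 * 4 ^ g)"
    unfolding power_mult power_mult_distrib[symmetric] power2_eq_square by simp
  finally show ?thesis .
qed

lemma gate_key_in_key_set:
  assumes "q ` {..<g} \<subseteq> {..<n}" "V \<in> unitary_mats (2 ^ g)"
  shows "gate_key M g q V \<in> key_set M g n"
proof -
  have fl: "\<lfloor>real M * x\<rfloor> \<in> {- int M..int M}" if "\<bar>x\<bar> \<le> 1" for x
  proof -
    have "\<bar>real M * x\<bar> \<le> real M"
      using that by (simp add: abs_mult mult_left_le)
    thus ?thesis by (auto simp: le_floor_iff floor_le_iff)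
  qed
  have "\<bar>Re (V $$ (r, c))\<bar> \<le> 1" "\<bar>Im (V $$ (r, c))\<bar> \<le> 1" if "r < 2 ^ g" "c < 2 ^ g" for r c
    using cmod_unitary_le_1[OF assms(2) that] abs_Re_le_cmod abs_Im_le_cmod order_trans by blast+
  thus ?thesis
    using assms(1) unfolding gate_key_def key_set_def
    by (auto intro!: fl simp del: atLeastAtMost_iff)
qed

text \<open>Equal floors put the real and imaginary parts within \<open>1 / M\<close> each, and the
  modulus is at most the sum of the two.\<close>

lemma vec_norm2_gate_on_diff_le_if_key_eq:
  assumes "gate_key M g q V = gate_key M g q' V'" and M: "0 < M"
    and q: "q ` {..<g} \<subseteq> {..<n}" "inj_on q {..<g}" and v: "v \<in> carrier_vec (2 ^ n)"
  shows "vec_norm2 (gate_on g n q V *\<^sub>v v - gate_on g n q' V' *\<^sub>v v) \<le> 2 ^ g * (2 / real M) * vec_norm2 v"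
proof -
  have "restrict q {..<g} i = restrict q' {..<g} i" for i
    using assms(1) by (simp add: gate_key_def)
  from this have "q' i = q i" if "i < g" for i
    using that by (metis lessThan_iff restrict_apply')
  hence eq: "gate_on g n q' V' = gate_on g n q V'"
    by (rule gate_on_cong)
  show ?thesis
    unfolding eq
  proof (rule vec_norm2_gate_on_diff_le[OF q v])
    fix x y :: nat assume xy: "x < 2 ^ g" "y < 2 ^ g"
    have "snd (gate_key M g q V) (x, y) = snd (gate_key M g q' V') (x, y)"
      by (simp add: assms(1))
    hence "\<lfloor>real M * Re (V $$ (x, y))\<rfloor> = \<lfloor>real M * Re (V' $$ (x, y))\<rfloor>"
      "\<lfloor>real M * Im (V $$ (x, y))\<rfloor> = \<lfloor>real M * Im (V' $$ (x, y))\<rfloor>"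
      using xy by (auto simp: gate_key_def)
    from this[THEN abs_diff_le_if_floor_eq[OF _ M]]
    have "\<bar>Re (V $$ (x, y) - V' $$ (x, y))\<bar> + \<bar>Im (V $$ (x, y) - V' $$ (x, y))\<bar> \<le> 2 / real M"
      by simp
    thus "cmod (V $$ (x, y) - V' $$ (x, y)) \<le> 2 / real M"
      using cmod_le order_trans by blast
  qed
qed

text \<open>The net keeps one genuine circuit for each attained list of keys. Rounded matrices
  themselves could fail to be unitary; with genuine circuits the error estimate applies and all
  outputs are probability distributions.\<close>

lemma circuits_net:
  assumes M: "0 < M"
  obtains F where "finite F" "F \<subseteq> circuits g b n"
    "card F \<le> (\<Sum>i\<le>b. (n ^ g * (2 * M + 1) ^ (2 * 4 ^ g)) ^ i)"
    "\<And>U. U \<in> circuits g b n \<Longrightarrow> \<exists>U'\<in>F. \<forall>v\<in>carrier_vec (2 ^ n).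
       vec_norm2 (U *\<^sub>v v - U' *\<^sub>v v) \<le> real b * (2 ^ g * (2 / real M)) * vec_norm2 v"
proof -
  let ?C = "\<lambda>Vs. foldr (*) Vs (1\<^sub>m (2 ^ n)) :: complex mat"
  let ?L = "{Vs. length Vs \<le> b \<and> set Vs \<subseteq> gates g n}"
  have "\<forall>G\<in>gates g n. \<exists>q V. G = gate_on g n q V \<and> q ` {..<g} \<subseteq> {..<n} \<and> inj_on q {..<g}
      \<and> V \<in> unitary_mats (2 ^ g)"
    unfolding gates_def by blast
  \<comment> \<open>A gate may come from several pairs of wiring and unitary matrix; fixing one pair
    for each gate makes its key well defined.\<close>
  then obtain Q W where QW: "\<And>G. G \<in> gates g n \<Longrightarrow> G = gate_on g n (Q G) (W G)
      \<and> Q G ` {..<g} \<subseteq> {..<n} \<and> inj_on (Q G) {..<g} \<and> W G \<in> unitary_mats (2 ^ g)"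
    by metis
  define \<kappa> where "\<kappa> G = gate_key M g (Q G) (W G)" for G
  have close: "vec_norm2 (G *\<^sub>v v - G' *\<^sub>v v) \<le> 2 ^ g * (2 / real M) * vec_norm2 v"
    if "G \<in> gates g n" "G' \<in> gates g n" "\<kappa> G = \<kappa> G'" "v \<in> carrier_vec (2 ^ n)" for G G' v
    using vec_norm2_gate_on_diff_le_if_key_eq[of M g "Q G" "W G" "Q G'" "W G'" n v] that QW M
    unfolding \<kappa>_def by metis
  \<comment> \<open>The representative has the same keys in the same order, hence also the same
    length.\<close>
  define rep where "rep = inv_into ?L (map \<kappa>)"
  define F where "F = (\<lambda>ks. ?C (rep ks)) ` map \<kappa> ` ?L"
  let ?K = "{ks. set ks \<subseteq> key_set M g n \<and> length ks \<le> b}"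
  have key: "\<kappa> G \<in> key_set M g n" if "G \<in> gates g n" for G
    unfolding \<kappa>_def using QW[OF that] by (intro gate_key_in_key_set) auto
  have sub: "map \<kappa> ` ?L \<subseteq> ?K"
  proof
    fix ks assume "ks \<in> map \<kappa> ` ?L"
    then obtain Vs where Vs: "ks = map \<kappa> Vs" "length Vs \<le> b" "set Vs \<subseteq> gates g n" by blast
    have "set ks \<subseteq> key_set M g n"
      unfolding Vs(1) set_map using key Vs(3) by blast
    thus "ks \<in> ?K" using Vs by simp
  qed
  have finK: "finite ?K" by (rule finite_lists_length_le[OF finite_key_set])
  have fin: "finite (map \<kappa> ` ?L)" using finite_subset[OF sub finK] .
  have rep: "rep (map \<kappa> Vs) \<in> ?L" "map \<kappa> (rep (map \<kappa> Vs)) = map \<kappa> Vs" if "Vs \<in> ?L" for Vs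
    unfolding rep_def using that by (auto intro!: inv_into_into[of _ "map \<kappa>" ?L, simplified] f_inv_into_f)
  show thesis
  proof
    show "finite F" unfolding F_def using fin by simp
    show "F \<subseteq> circuits g b n"
      using rep(1) by (fastforce simp: F_def circuits_def)
    have "card F \<le> card (map \<kappa> ` ?L)" unfolding F_def by (rule card_image_le[OF fin])
    also have "\<dots> \<le> card ?K" by (rule card_mono[OF finK sub])
    also have "\<dots> = (\<Sum>i\<le>b. (n ^ g * (2 * M + 1) ^ (2 * 4 ^ g)) ^ i)"
      using card_lists_length_le[OF finite_key_set, of M g n b] by (simp add: card_key_set)
    finally show "card F \<le> (\<Sum>i\<le>b. (n ^ g * (2 * M + 1) ^ (2 * 4 ^ g)) ^ i)" .
  next
    fix U assume "U \<in> circuits g b n"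
    then obtain Vs where Vs: "Vs \<in> ?L" "U = ?C Vs" by (auto simp: circuits_def)
    let ?Vs' = "rep (map \<kappa> Vs)"
    have "list_all2 (\<lambda>G G'. \<forall>w\<in>carrier_vec (2 ^ n).
        vec_norm2 (G *\<^sub>v w - G' *\<^sub>v w) \<le> 2 ^ g * (2 / real M) * vec_norm2 w) Vs ?Vs'"
    proof (rule list_all2_all_nthI)
      have map_eq: "map \<kappa> ?Vs' = map \<kappa> Vs" using rep(2) Vs by blast
      thus len: "length Vs = length ?Vs'" by (metis length_map)
      fix i assume i: "i < length Vs"
      have "\<kappa> (Vs ! i) = \<kappa> (?Vs' ! i)"
        using arg_cong[OF map_eq, of "\<lambda>xs. xs ! i"] i len by simp
      moreover have "Vs ! i \<in> gates g n" "?Vs' ! i \<in> gates g n"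
        using Vs rep(1)[OF Vs(1)] i len by (auto dest: nth_mem)
      ultimately show "\<forall>w\<in>carrier_vec (2 ^ n).
          vec_norm2 (Vs ! i *\<^sub>v w - ?Vs' ! i *\<^sub>v w) \<le> 2 ^ g * (2 / real M) * vec_norm2 w"
        using close by blast
    qed
    note diff = vec_norm2_foldr_gates_diff_le[OF this]
    have "vec_norm2 (U *\<^sub>v v - ?C ?Vs' *\<^sub>v v) \<le> real b * (2 ^ g * (2 / real M)) * vec_norm2 v"
      if v: "v \<in> carrier_vec (2 ^ n)" for v
    proof -
      have "vec_norm2 (U *\<^sub>v v - ?C ?Vs' *\<^sub>v v) \<le> real (length Vs) * (2 ^ g * (2 / real M)) * vec_norm2 v"
        unfolding Vs(2) using diff[of g v] rep(1)[OF Vs(1)] Vs(1) v by blast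
      also have "\<dots> \<le> real b * (2 ^ g * (2 / real M)) * vec_norm2 v"
        using Vs(1) by (intro mult_right_mono) auto
      finally show ?thesis .
    qed
    moreover have "?C ?Vs' \<in> F" unfolding F_def using Vs(1) by blast
    ultimately show "\<exists>U'\<in>F. \<forall>v\<in>carrier_vec (2 ^ n).
       vec_norm2 (U *\<^sub>v v - U' *\<^sub>v v) \<le> real b * (2 ^ g * (2 / real M)) * vec_norm2 v" by blast
  qed
qed

section \<open>From state vectors to output distributions\<close>

text \<open>Division by \<open>2 ^ m\<close> with remainder: for fixed \<open>c'\<close> the indices
  form a block of \<open>2 ^ m\<close> consecutive numbers.\<close>

lemma sum_power_two_split:
  fixes f :: "nat \<Rightarrow> 'a :: comm_monoid_add"
  assumes "m \<le> n"
  shows "(\<Sum>c<2 ^ m. \<Sum>c'<2 ^ (n - m). f (c + 2 ^ m * c')) = (\<Sum>i<2 ^ n. f i)"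
proof -
  have "(\<Sum>c<2 ^ m. \<Sum>c'<2 ^ (n - m). f (c + 2 ^ m * c')) = (\<Sum>c'<2 ^ (n - m). \<Sum>c<2 ^ m. f (c + 2 ^ m * c'))"
    by (rule sum.swap)
  also have "\<dots> = (\<Sum>c'<2 ^ (n - m). \<Sum>i=c' * 2 ^ m..<c' * 2 ^ m + 2 ^ m. f i)"
    by (simp add: sum.atLeastLessThan_shift_0[of f] add.commute mult.commute atLeast0LessThan)
  also have "\<dots> = (\<Sum>i<2 ^ (n - m) * 2 ^ m. f i)"
    by (rule sum.nat_group)
  also have "(2 :: nat) ^ (n - m) * 2 ^ m = 2 ^ n"
    using assms by (simp flip: power_add)
  finally show ?thesis .
qed

lemma sum_Prob:
  assumes "m \<le> n" "v \<in> carrier_vec (2 ^ n)"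
  shows "(\<Sum>c<2 ^ m. Prob m n v c) = (vec_norm2 v)\<^sup>2"
  using sum_power_two_split[OF assms(1), of "\<lambda>i. (cmod (v $ i))\<^sup>2"] assms(2)
  by (simp add: Prob_def vec_norm2_def L2_set_def sum_nonneg)

lemma Prob_nonneg: "c < 2 ^ m \<Longrightarrow> 0 \<le> Prob m n v c"
  by (simp add: Prob_def sum_nonneg)

text \<open>Passing to the marginal on \<open>m\<close> qubits cannot increase the distance. The
  full distributions are compared by factoring the difference of squared moduli, then by
  Cauchy-Schwarz and the triangle inequality.\<close>

lemma tvd_Prob_le:
  assumes "m \<le> n" and v: "v \<in> carrier_vec (2 ^ n)" and w: "w \<in> carrier_vec (2 ^ n)"
  shows "tvd (2 ^ m) (Prob m n v) (Prob m n w) \<le> vec_norm2 (v - w) * (vec_norm2 v + vec_norm2 w)"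
proof -
  let ?a = "\<lambda>i. cmod (v $ i - w $ i)" and ?b = "\<lambda>i. cmod (v $ i) + cmod (w $ i)"
  have pt: "\<bar>(cmod x)\<^sup>2 - (cmod y)\<^sup>2\<bar> \<le> cmod (x - y) * (cmod x + cmod y)" for x y
  proof -
    have "\<bar>(cmod x)\<^sup>2 - (cmod y)\<^sup>2\<bar> = \<bar>cmod x - cmod y\<bar> * (cmod x + cmod y)"
      by (simp add: power2_eq_square square_diff_square_factored abs_mult)
    also have "\<dots> \<le> cmod (x - y) * (cmod x + cmod y)"
      by (intro mult_right_mono norm_triangle_ineq3) auto
    finally show ?thesis .
  qed
  have "tvd (2 ^ m) (Prob m n v) (Prob m n w)
      = (\<Sum>c<2 ^ m. \<bar>\<Sum>c'<2 ^ (n - m). (cmod (v $ (c + 2 ^ m * c')))\<^sup>2 - (cmod (w $ (c + 2 ^ m * c')))\<^sup>2\<bar>)"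
    by (simp add: tvd_def Prob_def sum_subtractf)
  also have "\<dots> \<le> (\<Sum>c<2 ^ m. \<Sum>c'<2 ^ (n - m). ?a (c + 2 ^ m * c') * ?b (c + 2 ^ m * c'))"
    by (intro sum_mono order_trans[OF sum_abs] pt)
  also have "\<dots> = (\<Sum>i<2 ^ n. \<bar>?a i\<bar> * \<bar>?b i\<bar>)"
    using sum_power_two_split[OF assms(1), of "\<lambda>i. ?a i * ?b i"] by simp
  also have "\<dots> \<le> L2_set ?a {..<2 ^ n} * L2_set ?b {..<2 ^ n}"
    by (rule L2_set_mult_ineq)
  also have "L2_set ?a {..<2 ^ n} = vec_norm2 (v - w)"
    using v w by (auto simp: vec_norm2_def intro!: L2_set_cong)
  also have "L2_set ?b {..<2 ^ n} \<le> vec_norm2 v + vec_norm2 w"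
    using L2_set_triangle_ineq v w by (simp add: vec_norm2_def)
  finally show ?thesis by (simp add: mult_left_mono)
qed

lemma vec_norm2_unit_vec:
  assumes "j < d"
  shows "vec_norm2 (unit_vec d j) = 1"
proof -
  have "(\<Sum>i<d. (cmod (unit_vec d j $ i))\<^sup>2) = (\<Sum>i<d. if i = j then 1 else 0)"
    using assms by (intro sum.cong) auto
  thus ?thesis using assms by (simp add: vec_norm2_def L2_set_def)
qed

section \<open>Measure of the set of approximable tuples\<close>

text \<open>All logarithms are compared with \<open>ln x\<close> for
  \<open>x = 2 * b / \<epsilon>\<close>. Since \<open>\<epsilon> <= 2\<close>, this \<open>x\<close>
  is at least \<open>b\<close>, hence at least \<open>n\<close> and 2, and \<open>ln 2\<close> and
  \<open>ln n\<close> are absorbed.\<close>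

lemma ln_circuits_net_le:
  fixes \<epsilon> :: real
  assumes "2 \<le> b" "1 \<le> n" "n \<le> b" "1 \<le> g" "0 < \<epsilon>" "\<epsilon> \<le> 2"
  defines "M \<equiv> nat \<lceil>16 * real b * 2 ^ g / \<epsilon>\<rceil>"
  shows "ln (\<Sum>i\<le>b. (real (n ^ g * (2 * M + 1) ^ (2 * 4 ^ g))) ^ i) \<le> 2 ^ (7 * g) * real b * ln (2 * real b / \<epsilon>)"
proof -
  define x where "x = 2 * real b / \<epsilon>"
  define P where "P = n ^ g * (2 * M + 1) ^ (2 * 4 ^ g)"
  have xb: "real b \<le> x"
    using assms by (simp add: x_def field_simps)
  hence x2: "2 \<le> x" using assms by linarith
  hence L: "ln 2 \<le> ln x" "0 \<le> ln x" by auto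
  have "real M \<le> 16 * real b * 2 ^ g / \<epsilon> + 1"
    using assms unfolding M_def by (simp add: of_nat_nat)
  also have "16 * real b * 2 ^ g / \<epsilon> = 8 * (2 ^ g * x)"
    by (simp add: x_def)
  finally have M_le: "real M \<le> 8 * (2 ^ g * x) + 1" .
  \<comment> \<open>Lets the additive 3 in \<open>2 * M + 1 <= 16 * (2 ^ g * x) + 3\<close> be
    absorbed into the factor \<open>2 ^ 5\<close>.\<close>
  have "2 * 2 \<le> 2 ^ g * x"
    using x2 power_increasing[of 1 g "2::real"] \<open>1 \<le> g\<close> by (intro mult_mono) auto
  hence "real (2 * M + 1) \<le> 2 ^ 5 * 2 ^ g * x"
    using M_le by simp
  also have "\<dots> = 2 ^ (5 + g) * x"
    by (simp add: power_add)
  finally have "ln (real (2 * M + 1)) \<le> ln (2 ^ (5 + g) * x)"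
    using x2 by simp
  also have "\<dots> = real (5 + g) * ln 2 + ln x"
    using x2 by (simp add: ln_mult ln_realpow)
  also have "\<dots> \<le> real (5 + g) * ln x + ln x"
    using L by (intro add_right_mono mult_left_mono) auto
  also have "\<dots> \<le> 7 * real g * ln x"
    using mult_right_mono[OF _ L(2), of "real (5 + g) + 1" "7 * real g"] \<open>1 \<le> g\<close>
    by (simp add: algebra_simps)
  finally have lnM: "ln (real (2 * M + 1)) \<le> 7 * real g * ln x" .
  have lnn: "ln (real n) \<le> ln x"
    using assms xb by simp
  have "1 \<le> P" using assms by (simp add: P_def)
  have "ln (real P) = ln (real n ^ g) + ln (real (2 * M + 1) ^ (2 * 4 ^ g))"
    unfolding P_def of_nat_mult[of "n ^ g"] of_nat_power
    by (rule ln_mult_pos) (use \<open>1 \<le> n\<close> in simp_all)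
  also have "\<dots> = real g * ln (real n) + 2 * 4 ^ g * ln (real (2 * M + 1))"
    using ln_realpow[of "real n" g] ln_realpow[of "real (2 * M + 1)" "2 * 4 ^ g"] \<open>1 \<le> n\<close> by simp
  also have "\<dots> \<le> real g * ln x + 2 * 4 ^ g * (7 * real g * ln x)"
    using lnn lnM by (intro add_mono mult_left_mono) auto
  finally have lnP: "ln (real P) \<le> real g * ln x + 14 * real g * 4 ^ g * ln x"
    by (simp add: mult_ac)
  \<comment> \<open>The \<open>b + 1\<close> possible circuit lengths cost at most
    \<open>2 ^ b\<close>, that is one extra \<open>ln 2\<close> per gate.\<close>
  have "(\<Sum>i\<le>b. real P ^ i) \<le> (\<Sum>i\<le>b. real P ^ b)"
    using \<open>1 \<le> P\<close> by (intro sum_mono power_increasing) auto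
  also have "\<dots> = real (b + 1) * real P ^ b" by simp
  also have "\<dots> \<le> 2 ^ b * real P ^ b"
  proof (intro mult_right_mono)
    have "b + 1 \<le> 2 ^ b" using less_exp[of b] by linarith
    thus "real (b + 1) \<le> 2 ^ b" by (metis of_nat_le_iff of_nat_numeral of_nat_power)
  qed simp
  finally have sum_le: "(\<Sum>i\<le>b. real P ^ i) \<le> 2 ^ b * real P ^ b" .
  have "real P ^ 0 \<le> (\<Sum>i\<le>b. real P ^ i)"
    by (intro member_le_sum[of 0 "{..b}" "\<lambda>i. real P ^ i"]) auto
  hence "ln (\<Sum>i\<le>b. real P ^ i) \<le> ln (2 ^ b * real P ^ b)"
    using sum_le by simp
  also have "\<dots> = real b * (ln 2 + ln (real P))"
    using \<open>1 \<le> P\<close> by (simp add: ln_mult ln_realpow algebra_simps)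
  also have "\<dots> \<le> real b * (16 * real g * 4 ^ g * ln x)"
  proof (intro mult_left_mono)
    have "1 \<le> real g * 4 ^ g"
      using \<open>1 \<le> g\<close> mult_mono[of 1 "real g" 1 "4 ^ g"] by simp
    moreover have "real g \<le> real g * 4 ^ g"
      using mult_left_mono[of 1 "4 ^ g" "real g"] by simp
    ultimately have "(1 + real g + 14 * (real g * 4 ^ g)) * ln x \<le> 16 * (real g * 4 ^ g) * ln x"
      using L by (intro mult_right_mono) auto
    thus "ln 2 + ln (real P) \<le> 16 * real g * 4 ^ g * ln x"
      using lnP L by (simp add: algebra_simps)
  qed simp
  also have "\<dots> = 16 * real g * 4 ^ g * (real b * ln x)"
    by simp
  \<comment> \<open>The exponent 7 splits as 4 for the constant 16, 1 for \<open>g\<close> and 2 for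
    \<open>4 ^ g\<close>.\<close>
  also have "\<dots> \<le> 2 ^ (7 * g) * (real b * ln x)"
  proof (intro mult_right_mono)
    have "(2::real) ^ 4 \<le> 2 ^ (4 * g)"
      using \<open>1 \<le> g\<close> by (intro power_increasing) auto
    moreover have "real g \<le> 2 ^ g"
      using less_exp[of g] by (metis less_imp_le of_nat_le_iff of_nat_numeral of_nat_power)
    ultimately have "16 * real g * 4 ^ g \<le> 2 ^ (4 * g) * 2 ^ g * 4 ^ g"
      by (intro mult_right_mono mult_mono) auto
    also have "\<dots> = 2 ^ (4 * g) * 2 ^ g * 2 ^ (2 * g)"
      by (simp add: power_mult)
    also have "\<dots> = 2 ^ (7 * g)"
      by (simp flip: power_add)
    finally show "16 * real g * 4 ^ g \<le> 2 ^ (7 * g)" .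
  qed (use L in simp)
  finally show ?thesis
    by (simp add: P_def x_def mult.assoc del: of_nat_mult of_nat_power of_nat_add)
qed

section \<open>Covering the approximable tuples by overlap events\<close>

lemma phi_nonneg: "j < k \<Longrightarrow> i < 2 ^ m \<Longrightarrow> 0 \<le> phi m n k U j i"
  by (simp add: phi_def Prob_nonneg)

lemma vec_norm2_circuit:
  assumes "U \<in> circuits g b n" "j < 2 ^ n"
  shows "vec_norm2 (U *\<^sub>v unit_vec (2 ^ n) j) = 1" "U *\<^sub>v unit_vec (2 ^ n) j \<in> carrier_vec (2 ^ n)"
proof -
  from assms obtain Vs where Vs: "set Vs \<subseteq> gates g n" "U = foldr (*) Vs (1\<^sub>m (2 ^ n))"
    by (auto simp: circuits_def)
  show "vec_norm2 (U *\<^sub>v unit_vec (2 ^ n) j) = 1"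
    unfolding Vs(2) using vec_norm2_foldr_gates[OF Vs(1), of "unit_vec (2 ^ n) j"] assms(2)
    by (simp add: vec_norm2_unit_vec)
  show "U *\<^sub>v unit_vec (2 ^ n) j \<in> carrier_vec (2 ^ n)"
    unfolding Vs(2) using foldr_gates_carrier[OF Vs(1)] by (intro mult_mat_vec_carrier) auto
qed

lemma sum_phi:
  assumes "U \<in> circuits g b n" "m \<le> n" "k \<le> 2 ^ n" "j < k"
  shows "(\<Sum>i<2 ^ m. phi m n k U j i) = 1"
  using assms vec_norm2_circuit[OF assms(1), of j] by (simp add: phi_def sum_Prob)

lemma tvd_phi_le:
  assumes U: "U \<in> circuits g b n" "U' \<in> circuits g b n" and "m \<le> n" "k \<le> 2 ^ n" "j < k"
  shows "tvd (2 ^ m) (phi m n k U j) (phi m n k U' j)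
    \<le> 2 * vec_norm2 (U *\<^sub>v unit_vec (2 ^ n) j - U' *\<^sub>v unit_vec (2 ^ n) j)"
  using tvd_Prob_le[OF assms(3) vec_norm2_circuit(2)[OF U(1)] vec_norm2_circuit(2)[OF U(2)], of j j]
    vec_norm2_circuit(1)[OF U(1)] vec_norm2_circuit(1)[OF U(2)] assms(4,5)
  by (simp add: phi_def)

lemma overlap_eq_tvd:
  assumes "(\<Sum>i<D. x i) = 1" "(\<Sum>i<D. y i) = 1"
  shows "(\<Sum>i<D. min (x i) (y i)) = 1 - tvd D x y / 2"
proof -
  have "(\<Sum>i<D. min (x i) (y i)) = (\<Sum>i<D. (x i + y i - \<bar>x i - y i\<bar>) / 2)"
    by (intro sum.cong) (auto simp: min_def)
  also have "\<dots> = 1 - tvd D x y / 2"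
    using assms by (simp add: tvd_def sum_divide_distrib[symmetric] sum.distrib sum_subtractf diff_divide_distrib)
  finally show ?thesis .
qed

lemma overlap_diff_le_tvd:
  "(\<Sum>i<D. min (x i) (y i)) \<le> (\<Sum>i<D. min (x i) (y' i)) + tvd D y y'"
  unfolding tvd_def sum.distrib[symmetric] by (intro sum_mono) auto

text \<open>A union bound over the net: each approximable tuple has large total overlap with the
  output of some net circuit, and each such event is rare by the Chernoff bound.\<close>

lemma measure_X_set_le:
  fixes \<epsilon> :: real
  assumes "2 \<le> b" "1 \<le> n" "n \<le> b" "1 \<le> g" "m < n" "1 \<le> k" "k \<le> 2 ^ n" "2 \<le> N" "N \<le> 2 ^ m" "0 < \<epsilon>"
  defines "M \<equiv> nat \<lceil>16 * real b * 2 ^ g / \<epsilon>\<rceil>"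
  shows "measure (tuple_unif k N (2 ^ m)) (X_set b g m n N (2 - \<epsilon>) k)
    \<le> (\<Sum>i\<le>b. real (n ^ g * (2 * M + 1) ^ (2 * 4 ^ g)) ^ i)
      * exp (- ((\<epsilon> / 16 - 8 * sqrt (real N / 2 ^ m)) * real N * real k))"
proof -
  let ?T = "tuple_unif k N (2 ^ m)" and ?X = "X_set b g m n N (2 - \<epsilon>) k"
  let ?e = "exp (- ((\<epsilon> / 16 - 8 * sqrt (real N / 2 ^ m)) * real N * real k))"
  interpret prob_space ?T by (rule prob_space_tuple_unif[OF assms(9)])
  have mn: "m \<le> n" using assms by simp
  have M: "16 * real b * 2 ^ g / \<epsilon> \<le> real M" unfolding M_def by (rule real_nat_ceiling_ge)
  moreover have "0 < 16 * real b * 2 ^ g / \<epsilon>" using assms by simp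
  ultimately have "0 < real M" by linarith
  hence Mpos: "0 < M" by simp
  obtain F where F: "finite F" "F \<subseteq> circuits g b n"
    "card F \<le> (\<Sum>i\<le>b. (n ^ g * (2 * M + 1) ^ (2 * 4 ^ g)) ^ i)"
    "\<And>U. U \<in> circuits g b n \<Longrightarrow> \<exists>U'\<in>F. \<forall>v\<in>carrier_vec (2 ^ n).
       vec_norm2 (U *\<^sub>v v - U' *\<^sub>v v) \<le> real b * (2 ^ g * (2 / real M)) * vec_norm2 v"
    using circuits_net[OF Mpos] by metis
  \<comment> \<open>Average distance at most \<open>2 - \<epsilon>\<close> means total overlap at
    least \<open>k * \<epsilon> / 2\<close>; passing to the net costs at most
    \<open>k * \<epsilon> / 4\<close>.\<close>
  define B where "B U = {x \<in> space ?T. real k * \<epsilon> / 4 \<le> (\<Sum>j<k. \<Sum>i<2 ^ m. min (x j i) (phi m n k U j i))}" for U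
  have B: "B U \<in> sets ?T" "measure ?T (B U) \<le> ?e" if "U \<in> F" for U
  proof -
    have U: "U \<in> circuits g b n" using that F by blast
    have "measure ?T (B U) \<le> exp (real k * (8 * real N * sqrt (real N / real (2 ^ m))) - real N / 4 * (real k * \<epsilon> / 4))"
      unfolding B_def using assms phi_nonneg sum_phi[OF U mn assms(7)]
      by (intro measure_tuple_unif_overlap_le(2)) auto
    \<comment> \<open>The coefficient \<open>1 / 16\<close> is the factor \<open>1 / 4\<close> from
      the Markov parameter times the \<open>1 / 4\<close> in the overlap threshold.\<close>
    also have "\<dots> = ?e" by (simp add: algebra_simps)
    finally show "measure ?T (B U) \<le> ?e" .
    show "B U \<in> sets ?T"
      unfolding B_def using assms phi_nonneg sum_phi[OF U mn assms(7)]
      by (intro measure_tuple_unif_overlap_le(1)) auto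
  qed
  have "?X \<subseteq> (\<Union>U\<in>F. B U)"
  proof
    fix x assume "x \<in> ?X"
    then obtain U where x: "x \<in> {..<k} \<rightarrow>\<^sub>E sparse_simplex N (2 ^ m)" and U: "U \<in> circuits g b n"
      and avg: "avg_tvd k (2 ^ m) x (phi m n k U) \<le> 2 - \<epsilon>"
      by (auto simp: X_set_def)
    from F(4)[OF U] obtain U' where U': "U' \<in> F" and near: "\<And>v. v \<in> carrier_vec (2 ^ n) \<Longrightarrow>
        vec_norm2 (U *\<^sub>v v - U' *\<^sub>v v) \<le> real b * (2 ^ g * (2 / real M)) * vec_norm2 v"
      by blast
    have U'c: "U' \<in> circuits g b n" using U' F by blast
    have xj: "x j \<in> extensional {..<2 ^ m}" "(\<Sum>i<2 ^ m. x j i) = 1" if "j < k" for j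
    proof -
      have "x j \<in> sparse_simplex N (2 ^ m)" using x that by auto
      thus "x j \<in> extensional {..<2 ^ m}" "(\<Sum>i<2 ^ m. x j i) = 1"
        by (auto simp: sparse_simplex_def simplex_face_def prob_simplex_def)
    qed
    have sp: "space (sparse_unif N (2 ^ m)) = extensional {..<2 ^ m}"
      using sets_eq_imp_space_eq[OF sets_sparse_unif[OF assms(9)]] by (simp add: space_PiM PiE_def)
    have "x \<in> space ?T"
      using x xj(1) by (auto simp: tuple_unif_def space_PiM sp PiE_iff)
    have "(1 - tvd (2 ^ m) (x j) (phi m n k U j) / 2) - \<epsilon> / 4
        \<le> (\<Sum>i<2 ^ m. min (x j i) (phi m n k U' j i))" if j: "j < k" for j
    proof -
      have "j < 2 ^ n" using j assms by simp
      have "tvd (2 ^ m) (phi m n k U j) (phi m n k U' j)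
          \<le> 2 * vec_norm2 (U *\<^sub>v unit_vec (2 ^ n) j - U' *\<^sub>v unit_vec (2 ^ n) j)"
        by (rule tvd_phi_le[OF U U'c mn assms(7) j])
      also have "\<dots> \<le> 2 * (real b * (2 ^ g * (2 / real M)))"
        using near[of "unit_vec (2 ^ n) j"] vec_norm2_unit_vec[OF \<open>j < 2 ^ n\<close>] by simp
      \<comment> \<open>The factor 16 in \<open>M\<close> is chosen to make
        \<open>4 * b * 2 ^ g / M\<close> at most \<open>\<epsilon> / 4\<close>.\<close>
      also have "\<dots> \<le> \<epsilon> / 4"
        using M \<open>0 < real M\<close> \<open>0 < \<epsilon>\<close> by (simp add: field_simps)
      finally have "tvd (2 ^ m) (phi m n k U j) (phi m n k U' j) \<le> \<epsilon> / 4" .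
      thus ?thesis
        using overlap_diff_le_tvd[where x = "x j" and y = "phi m n k U j" and y' = "phi m n k U' j" and D = "2 ^ m"]
          overlap_eq_tvd[OF xj(2)[OF j] sum_phi[OF U mn assms(7) j]] by linarith
    qed
    hence "(\<Sum>j<k. (1 - tvd (2 ^ m) (x j) (phi m n k U j) / 2) - \<epsilon> / 4)
        \<le> (\<Sum>j<k. \<Sum>i<2 ^ m. min (x j i) (phi m n k U' j i))"
      by (intro sum_mono) auto
    moreover have "(\<Sum>j<k. (1 - tvd (2 ^ m) (x j) (phi m n k U j) / 2) - \<epsilon> / 4)
        = real k - real k * avg_tvd k (2 ^ m) x (phi m n k U) / 2 - real k * \<epsilon> / 4"
    proof -
      have "real k * avg_tvd k (2 ^ m) x (phi m n k U) = (\<Sum>j<k. tvd (2 ^ m) (x j) (phi m n k U j))"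
        using assms(6) by (simp add: avg_tvd_def)
      thus ?thesis by (simp add: sum_subtractf sum_divide_distrib[symmetric])
    qed
    moreover have "real k * avg_tvd k (2 ^ m) x (phi m n k U) \<le> real k * (2 - \<epsilon>)"
      using avg by (intro mult_left_mono) auto
    ultimately have "real k * \<epsilon> / 4 \<le> (\<Sum>j<k. \<Sum>i<2 ^ m. min (x j i) (phi m n k U' j i))"
      by (simp add: algebra_simps)
    thus "x \<in> (\<Union>U\<in>F. B U)"
      using U' \<open>x \<in> space ?T\<close> by (auto simp: B_def)
  qed
  hence "measure ?T ?X \<le> measure ?T (\<Union>U\<in>F. B U)"
    using B(1) F(1) by (intro finite_measure_mono) auto
  also have "\<dots> \<le> (\<Sum>U\<in>F. measure ?T (B U))"
    using B(1) F(1) by (intro finite_measure_subadditive_finite) auto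
  also have "\<dots> \<le> real (card F) * ?e"
    using B(2) by (rule sum_bounded_above)
  also have "\<dots> \<le> real (\<Sum>i\<le>b. (n ^ g * (2 * M + 1) ^ (2 * 4 ^ g)) ^ i) * ?e"
    using F(3) by (intro mult_right_mono) (simp_all only: of_nat_le_iff exp_ge_zero)
  finally show ?thesis by (simp only: of_nat_sum of_nat_power)
qed

section \<open>The bound in logarithmic form\<close>

lemma eln_measure_X_set_le:
  fixes \<epsilon> \<gamma> :: real
  assumes "n \<le> b" "m < n" "1 \<le> m" "1 \<le> g" "1 \<le> k" "k \<le> 2 ^ n" "2 \<le> N" "N \<le> 2 ^ m"
    and \<gamma>: "real N = \<gamma> * 2 ^ m" and \<epsilon>: "0 < \<epsilon>" "\<epsilon> \<le> 2"
  shows "eln (measure (tuple_unif k N (2 ^ m)) (X_set b g m n N (2 - \<epsilon>) k))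
    \<le> ereal (2 powr (7 * real g) * real b * ln (2 * real b / \<epsilon>) + 1 * real m * real k
         - (1 / 16 * \<epsilon> - 8 * \<gamma> powr (1 / 4)) * \<gamma> * 2 ^ m * real k)"
proof -
  let ?p = "measure (tuple_unif k N (2 ^ m)) (X_set b g m n N (2 - \<epsilon>) k)"
  let ?K = "\<Sum>i\<le>b. real (n ^ g * (2 * nat \<lceil>16 * real b * 2 ^ g / \<epsilon>\<rceil> + 1) ^ (2 * 4 ^ g)) ^ i"
  let ?a = "(\<epsilon> / 16 - 8 * sqrt (real N / 2 ^ m)) * real N * real k"
  have g: "real N / 2 ^ m = \<gamma>" using \<gamma> by simp
  have "0 < \<gamma>" using assms(7) by (simp flip: g)
  have "\<gamma> \<le> 1"
  proof -
    have "real N \<le> 2 ^ m" using assms(8) by (metis of_nat_le_iff of_nat_numeral of_nat_power)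
    thus ?thesis by (simp flip: g)
  qed
  \<comment> \<open>The moment bound carries \<open>sqrt \<gamma>\<close>; as
    \<open>\<gamma> <= 1\<close>, the smaller exponent gives the larger power.\<close>
  have "sqrt \<gamma> \<le> \<gamma> powr (1 / 4)"
    using \<open>0 < \<gamma>\<close> \<open>\<gamma> \<le> 1\<close> by (simp add: powr_half_sqrt[symmetric] powr_mono')
  hence a: "(1 / 16 * \<epsilon> - 8 * \<gamma> powr (1 / 4)) * \<gamma> * 2 ^ m * real k \<le> ?a"
    unfolding g \<gamma> mult.assoc using \<open>0 < \<gamma>\<close> by (intro mult_right_mono) auto
  have p: "?p \<le> ?K * exp (- ?a)"
    using assms by (intro measure_X_set_le) auto
  show ?thesis
  proof (cases "?p = 0")
    case True
    \<comment> \<open>Here \<open>eln\<close> takes the value minus infinity.\<close>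
    thus ?thesis by (simp add: eln_def)
  next
    case False
    hence "0 < ?p" using zero_less_measure_iff by blast
    hence "0 < ?K * exp (- ?a)" using p by linarith
    hence "0 < ?K" by (simp only: zero_less_mult_pos2[OF _ exp_gt_zero])
    have "ln ?p \<le> ln (?K * exp (- ?a))"
      using p \<open>0 < ?p\<close> by simp
    also have "\<dots> = ln ?K - ?a"
      using \<open>0 < ?K\<close> by (simp only: ln_mult_pos[OF _ exp_gt_zero] ln_exp diff_conv_add_uminus)
    also have "ln ?K \<le> 2 ^ (7 * g) * real b * ln (2 * real b / \<epsilon>)"
      using assms by (intro ln_circuits_net_le) auto
    also have "(2::real) ^ (7 * g) = 2 powr (7 * real g)"
      by (simp flip: powr_realpow)
    finally have "ln ?p \<le> 2 powr (7 * real g) * real b * ln (2 * real b / \<epsilon>) - ?a"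
      by simp
    moreover have "0 \<le> 1 * real m * real k" by simp
    ultimately have "ln ?p \<le> 2 powr (7 * real g) * real b * ln (2 * real b / \<epsilon>) + 1 * real m * real k
         - (1 / 16 * \<epsilon> - 8 * \<gamma> powr (1 / 4)) * \<gamma> * 2 ^ m * real k"
      using a by linarith
    thus ?thesis
      using False by (simp add: eln_def)
  qed
qed

theorem theorem2p3:
  shows "\<exists>c1 c2 c3 c4 :: real. c1 > 0 \<and> c2 > 0 \<and> c3 > 0 \<and> c4 > 0 \<and>
    (\<forall>(b::nat) (g::nat) (m::nat) (n::nat) (k::nat) (N::nat) (\<gamma>::real) (\<epsilon>::real).
       b \<ge> n \<longrightarrow> n > m \<longrightarrow> m \<ge> 1 \<longrightarrow> 1 \<le> g \<longrightarrow> g \<le> n \<longrightarrow> 1 \<le> k \<longrightarrow> k \<le> 2 ^ n \<longrightarrow>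
       2 \<le> N \<longrightarrow> N \<le> 2 ^ m \<longrightarrow> real N = \<gamma> * 2 ^ m \<longrightarrow> 0 < \<epsilon> \<longrightarrow> \<epsilon> \<le> 2 \<longrightarrow>
       eln (measure (tuple_unif k N (2 ^ m)) (X_set b g m n N (2 - \<epsilon>) k))
         \<le> ereal (2 powr (c1 * real g) * real b * ln (2 * real b / \<epsilon>) + c2 * real m * real k
              - (c3 * \<epsilon> - c4 * \<gamma> powr (1 / 4)) * \<gamma> * 2 ^ m * real k))"
\<comment> \<open>The witness 7 is the exponent from the size of the net; \<open>1 / 16\<close> and
  8 come from the Chernoff bound, the latter being the constant of the one-point moment.\<close>
proof (rule exI[of _ 7], rule exI[of _ 1], rule exI[of _ "1 / 16"], rule exI[of _ 8],
    intro conjI allI impI)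
  fix b g m n k N :: nat and \<gamma> \<epsilon> :: real
  assume "b \<ge> n" "n > m" "m \<ge> 1" "1 \<le> g" "1 \<le> k" "k \<le> 2 ^ n" "2 \<le> N" "N \<le> 2 ^ m"
    "real N = \<gamma> * 2 ^ m" "0 < \<epsilon>" "\<epsilon> \<le> 2"
  thus "eln (measure (tuple_unif k N (2 ^ m)) (X_set b g m n N (2 - \<epsilon>) k))
    \<le> ereal (2 powr (7 * real g) * real b * ln (2 * real b / \<epsilon>) + 1 * real m * real k
         - (1 / 16 * \<epsilon> - 8 * \<gamma> powr (1 / 4)) * \<gamma> * 2 ^ m * real k)"
    by (rule eln_measure_X_set_le)
qed simp_all

end
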